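(* For every convex polytope $X$ (in some affine space, swept by the linear function $p\cdot x$) and every vertex $v$ of $X$, define the $\mathbf{cd}$-polynomial $\Phi_v(X)$ recursively: if $\dim X=0$ then $\Phi_v(X)=1$; if $\dim X>0$ then \[\Phi_v(X)=\mathbf{d}\,\Phi(R_v)+\sum_{w\in\mathrm{vert}(Q_v)\cap H_v^+}\mathbf{c}\,\Phi_w(Q_v),\] where $Q_v,R_v,H_v^+$ are taken with respect to $X$. Then for every convex $d$-polytope $P$ (with $p$ generic), \[\Phi(P)=\sum_{v\in\mathrm{vert}(P)}\Phi_v(P).\]
   Context: For a convex $d$-polytope $P$: an $S$-chain for $S=\{s_1<\dots<s_k\}\subseteq\{0,\dots,d-1\}$ is a chain $F_1\subset\cdots\subset F_k$ of faces with $\dim F_i=s_i$; $f_S(P)$ is their number; $h_S(P)=\sum_{T\subseteq S}(-1)^{|S|-|T|}f_T(P)$; the $\mathbf{ab}$-index is $\Psi(P)=\sum_S h_S(P)w_S$, where $w_S=w_0\cdots w_{d-1}$ in noncommuting $\mathbf{a},\mathbf{b}$ with $w_i=\mathbf{b}$ if $i\in S$, $\mathbf{a}$ otherwise. The $\mathbf{cd}$-index $\Phi(P)$ is the polynomial in noncommuting $\mathbf{c},\mathbf{d}$ such that substituting $\mathbf{c}=\mathbf{a}+\mathbf{b}$, $\mathbf{d}=\mathbf{ab}+\mathbf{ba}$ gives $\Psi(P)$; for a point $\Phi=1$, and by convention $\Phi(\emptyset)=0$. Sweeping: fix $p\in\mathbb{R}^d$ generic, so that $p\cdot x$ takes distinct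 values on the vertices of $P$ and of all polytopes arising below and recursively. For a vertex $v$ of a polytope $X$ of positive dimension: $Q_v$ is the vertex figure obtained by cutting $X$ with a hyperplane parallel to a supporting hyperplane meeting $X$ only in $v$, translated a sufficiently small depth into $X$ (so $Q_v$ is a $(\dim X-1)$-polytope whose vertices lie on the edges of $X$ at $v$); $H_v=\{x:p\cdot x=p\cdot v\}$, $H_v^+=\{x:p\cdot x>p\cdot v\}$; $R_v=Q_v\cap H_v$, which is empty iff $v$ minimizes or maximizes $p\cdot x$ over $X$, and otherwise has dimension $\dim X-2$. $Q_v$ and $R_v$ are swept by the same function $p\cdot x$. *)

theory Defs
  imports "HOL-Analysis.Analysis" "HOL-Library.Poly_Mapping"
begin

section \<open>Noncommutative polynomials\<close>

text \<open>
  Integer polynomials in noncommuting variables are the monoid ring of the free monoid.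
  The monoid is written additively because this is what the convolution product of
  \<^theory>\<open>HOL-Library.Poly_Mapping\<close> expects.
\<close>

datatype 'x free_word = Word (letters: "'x list")

instantiation free_word :: (type) monoid_add
begin

definition zero_free_word :: "'x free_word" where
  "zero_free_word = Word []"

definition plus_free_word :: "'x free_word \<Rightarrow> 'x free_word \<Rightarrow> 'x free_word" where
  "plus_free_word u v = Word (letters u @ letters v)"

instance
  by standard (simp_all add: zero_free_word_def plus_free_word_def)

end

type_synonym 'x ncpoly = "'x free_word \<Rightarrow>\<^sub>0 int"

definition ncvar :: "'x \<Rightarrow> 'x ncpoly" where
  "ncvar x = Poly_Mapping.single (Word [x]) 1"

definition ncsubst :: "('x \<Rightarrow> 'y ncpoly) \<Rightarrow> 'x ncpoly \<Rightarrow> 'y ncpoly" where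
  "ncsubst \<sigma> f =
    (\<Sum>u\<in>Poly_Mapping.keys f.
       of_int (Poly_Mapping.lookup f u) * prod_list (map \<sigma> (letters u)))"

datatype ab = letter_a | letter_b
datatype cd = letter_c | letter_d

fun cd_to_ab :: "cd \<Rightarrow> ab ncpoly" where
  "cd_to_ab letter_c = ncvar letter_a + ncvar letter_b"
| "cd_to_ab letter_d = ncvar letter_a * ncvar letter_b + ncvar letter_b * ncvar letter_a"

section \<open>The ab-index and the cd-index\<close>

abbreviation vert :: "'a::real_vector set \<Rightarrow> 'a set" where
  "vert X \<equiv> {v. v extreme_point_of X}"

definition S_chains :: "'a::euclidean_space set \<Rightarrow> nat set \<Rightarrow> 'a set list set" where
  "S_chains P S =
    {Fs. (\<forall>F\<in>set Fs. F face_of P) \<and> sorted_wrt (\<subset>) Fs \<and>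
         map aff_dim Fs = map int (sorted_list_of_set S)}"

definition flag_f :: "'a::euclidean_space set \<Rightarrow> nat set \<Rightarrow> nat" where
  "flag_f P S = card (S_chains P S)"

definition flag_h :: "'a::euclidean_space set \<Rightarrow> nat set \<Rightarrow> int" where
  "flag_h P S = (\<Sum>T\<in>Pow S. (- 1) ^ (card S - card T) * int (flag_f P T))"

definition ab_word :: "nat \<Rightarrow> nat set \<Rightarrow> ab ncpoly" where
  "ab_word d S = prod_list (map (\<lambda>i. if i \<in> S then ncvar letter_b else ncvar letter_a) [0..<d])"

definition ab_index :: "'a::euclidean_space set \<Rightarrow> ab ncpoly" where
  "ab_index P =
    (let d = nat (aff_dim P) in \<Sum>S\<in>Pow {..<d}. of_int (flag_h P S) * ab_word d S)"

definition cd_index :: "'a::euclidean_space set \<Rightarrow> cd ncpoly" where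
  "cd_index P = (if P = {} then 0 else (THE \<Phi>. ncsubst cd_to_ab \<Phi> = ab_index P))"

section \<open>Vertex figures and sweeping\<close>

text \<open>
  The depth \<open>\<epsilon>\<close> is sufficiently small when the translated hyperplane still strictly
  separates \<open>v\<close> from all the other vertices.
\<close>

definition vertex_figure :: "'a::euclidean_space set \<Rightarrow> 'a \<Rightarrow> 'a set \<Rightarrow> bool" where
  "vertex_figure X v Q \<longleftrightarrow>
    (\<exists>u \<epsilon>. X \<subseteq> {x. u \<bullet> x \<ge> u \<bullet> v} \<and> X \<inter> {x. u \<bullet> x = u \<bullet> v} = {v} \<and>
           \<epsilon> > 0 \<and> (\<forall>y\<in>vert X - {v}. u \<bullet> v + \<epsilon> < u \<bullet> y) \<and>
           Q = X \<inter> {x. u \<bullet> x = u \<bullet> v + \<epsilon>})"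

text \<open>
  A vertex figure depends on the supporting hyperplane and on the depth. A function \<open>Q\<close>
  as below fixes these choices; \<open>Q X v\<close> is then the vertex figure of \<open>X\<close> at \<open>v\<close>.
\<close>

definition vertex_figure_choice :: "('a::euclidean_space set \<Rightarrow> 'a \<Rightarrow> 'a set) \<Rightarrow> bool" where
  "vertex_figure_choice Q \<longleftrightarrow>
    (\<forall>X v. polytope X \<and> aff_dim X > 0 \<and> v \<in> vert X \<longrightarrow> vertex_figure X v (Q X v))"

inductive_set iterated_figures ::
  "('a::euclidean_space set \<Rightarrow> 'a \<Rightarrow> 'a set) \<Rightarrow> 'a set \<Rightarrow> 'a set set"
  for Q P where
  base: "P \<in> iterated_figures Q P"
| step: "X \<in> iterated_figures Q P \<Longrightarrow> aff_dim X > 0 \<Longrightarrow> v \<in> vert X \<Longrightarrow>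
           Q X v \<in> iterated_figures Q P"

text \<open>
  The slices \<open>R\<^sub>v\<close> are not subject to the genericity condition: \<open>p\<close> is constant on each
  of them, and only their cd-indices enter the recursion.
\<close>

definition sweep_generic ::
  "('a::euclidean_space set \<Rightarrow> 'a \<Rightarrow> 'a set) \<Rightarrow> 'a set \<Rightarrow> 'a \<Rightarrow> bool" where
  "sweep_generic Q P p \<longleftrightarrow> (\<forall>X\<in>iterated_figures Q P. inj_on (\<lambda>x. p \<bullet> x) (vert X))"

text \<open>
  The recursion descends along the dimension of \<open>X\<close>, which is carried as an extra argument;
  the recursion equations in terms of the dimension itself are derived below.
\<close>

primrec sweep_cd_aux ::
  "('a::euclidean_space set \<Rightarrow> 'a \<Rightarrow> 'a set) \<Rightarrow> 'a \<Rightarrow> nat \<Rightarrow> 'a set \<Rightarrow> 'a \<Rightarrow> cd ncpoly" where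
  "sweep_cd_aux Q p 0 X v = 1"
| "sweep_cd_aux Q p (Suc n) X v =
     ncvar letter_d * cd_index (Q X v \<inter> {x. p \<bullet> x = p \<bullet> v}) +
     (\<Sum>w\<in>vert (Q X v) \<inter> {x. p \<bullet> x > p \<bullet> v}. ncvar letter_c * sweep_cd_aux Q p n (Q X v) w)"

definition sweep_cd ::
  "('a::euclidean_space set \<Rightarrow> 'a \<Rightarrow> 'a set) \<Rightarrow> 'a \<Rightarrow> 'a set \<Rightarrow> 'a \<Rightarrow> cd ncpoly" where
  "sweep_cd Q p X v = sweep_cd_aux Q p (nat (aff_dim X)) X v"

lemma aff_dim_vertex_figure:
  fixes X :: "'a::euclidean_space set"
  assumes X: "polytope X" "aff_dim X > 0" and v: "v \<in> vert X" and Q: "vertex_figure X v Q"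
  shows "aff_dim Q = aff_dim X - 1"
proof -
  from Q obtain u e where sup: "X \<inter> {x. u \<bullet> x = u \<bullet> v} = {v}" "e > 0"
    and far: "\<And>y. y \<in> vert X - {v} \<Longrightarrow> u \<bullet> v + e < u \<bullet> y"
    and Qe: "Q = X \<inter> {x. u \<bullet> x = u \<bullet> v + e}"
    unfolding vertex_figure_def by auto
  define b where "b = u \<bullet> v + e"
  let ?H = "{x. u \<bullet> x = b}"
  have cX: "convex X" and vX: "v \<in> X"
    using X v polytope_imp_convex by (auto simp: extreme_point_of_def)
  have "X = convex hull (vert X)"
    using X(1) Krein_Milman_Minkowski[of X] polytope_imp_compact polytope_imp_convex by blast
  then have "\<not> vert X \<subseteq> {v}"
    using X(2) aff_dim_convex_hull[of "vert X"] aff_dim_subset[of "vert X" "{v}"]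
    by (metis aff_dim_sing linorder_not_less)
  then obtain y where y: "y \<in> vert X" "y \<noteq> v" by blast
  then have yX: "y \<in> X" and yb: "u \<bullet> y > b" and vb: "u \<bullet> v < b"
    using far sup(2) by (auto simp: extreme_point_of_def b_def)
  have "rel_interior X \<noteq> {}"
    using cX vX rel_interior_eq_empty by blast
  then obtain z where z: "z \<in> rel_interior X" by blast
  have mid: "\<exists>m\<in>rel_interior X. u \<bullet> m = b"
    if t: "t \<in> X" "(u \<bullet> z - b) * (u \<bullet> t - b) < 0" for t
  proof -
    define l where "l = (u \<bullet> z - b) / (u \<bullet> z - u \<bullet> t)"
    have ne: "u \<bullet> z - u \<bullet> t \<noteq> 0" using t(2) by (auto simp: mult_less_0_iff)
    have l: "0 < l" "l < 1"
      using t(2) unfolding l_def mult_less_0_iff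
      by (smt (verit) zero_less_divide_iff divide_less_eq_1)+
    have "t - (1 - l) *\<^sub>R (t - z) \<in> rel_interior X"
      using rel_interior_convex_shrink[OF cX z t(1), of "1 - l"] l by auto
    moreover have "l * (u \<bullet> z - u \<bullet> t) = u \<bullet> z - b"
      using ne by (simp add: l_def)
    then have "u \<bullet> (t - (1 - l) *\<^sub>R (t - z)) = b"
      by (simp add: inner_diff_right algebra_simps)
    ultimately show ?thesis by blast
  qed
  have "\<exists>m\<in>rel_interior X. u \<bullet> m = b"
  proof (cases "u \<bullet> z" b rule: linorder_cases)
    case less
    then show ?thesis using mid[OF yX] yb by (simp add: mult_neg_pos)
  next
    case greater
    then show ?thesis using mid[OF vX] vb by (simp add: mult_pos_neg)
  qed (use z in auto)
  then obtain m where m: "m \<in> rel_interior X" "u \<bullet> m = b" by blast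
  let ?L = "affine hull X \<inter> ?H"
  have aL: "affine ?L" by (simp add: affine_Int affine_hyperplane)
  obtain T where "open T" "rel_interior X = affine hull X \<inter> T"
    using openin_rel_interior[of X] by (auto simp: openin_open)
  then have "open T" "rel_interior X \<inter> ?L = ?L \<inter> T" by auto
  then have op: "openin (top_of_set ?L) (rel_interior X \<inter> ?L)"
    by (metis openin_open)
  have sub: "rel_interior X \<inter> ?L \<subseteq> Q" "Q \<subseteq> ?L"
    using rel_interior_subset hull_subset[of X affine] by (auto simp: Qe b_def)
  have "m \<in> rel_interior X \<inter> ?L"
    using m rel_interior_subset hull_subset[of X affine] by blast
  then have "aff_dim (rel_interior X \<inter> ?L) = aff_dim ?L"
    using aff_dim_openin[OF op aL] by blast
  then have "aff_dim Q = aff_dim ?L"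
    using aff_dim_subset[OF sub(1)] aff_dim_subset[OF sub(2)] by linarith
  also have "\<dots> = aff_dim X - 1"
  proof -
    have "?L \<noteq> {}"
      using \<open>m \<in> rel_interior X \<inter> ?L\<close> by blast
    moreover have "v \<in> affine hull X" "v \<notin> ?H"
      using vX vb by (auto simp: hull_inc)
    then have "\<not> affine hull X \<subseteq> ?H" by blast
    ultimately show ?thesis
      using aff_dim_affine_Int_hyperplane[of "affine hull X" u b] by (auto simp: aff_dim_affine_hull)
  qed
  finally show ?thesis .
qed

lemma sweep_cd_rec:
  fixes X :: "'a::euclidean_space set"
  assumes "vertex_figure_choice Q" and "polytope X" and "v \<in> vert X"
  shows "aff_dim X = 0 \<Longrightarrow> sweep_cd Q p X v = 1"
    and "aff_dim X > 0 \<Longrightarrow> sweep_cd Q p X v =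
      ncvar letter_d * cd_index (Q X v \<inter> {x. p \<bullet> x = p \<bullet> v}) +
      (\<Sum>w\<in>vert (Q X v) \<inter> {x. p \<bullet> x > p \<bullet> v}. ncvar letter_c * sweep_cd Q p (Q X v) w)"
proof -
  show "aff_dim X = 0 \<Longrightarrow> sweep_cd Q p X v = 1"
    by (simp add: sweep_cd_def)
next
  assume pos: "aff_dim X > 0"
  then have "aff_dim (Q X v) = aff_dim X - 1"
    using assms aff_dim_vertex_figure unfolding vertex_figure_choice_def by blast
  with pos have "nat (aff_dim X) = Suc (nat (aff_dim (Q X v)))" by simp
  then show "sweep_cd Q p X v =
      ncvar letter_d * cd_index (Q X v \<inter> {x. p \<bullet> x = p \<bullet> v}) +
      (\<Sum>w\<in>vert (Q X v) \<inter> {x. p \<bullet> x > p \<bullet> v}. ncvar letter_c * sweep_cd Q p (Q X v) w)"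
    by (simp add: sweep_cd_def)
qed

end

theory Submission
  imports Defs
begin

text \<open>
  Give a face \<open>F\<close> of \<open>X\<close> the weight \<open>W(F) = (a - b)\<^bsup>dim F\<^esup> b \<Psi>(X/F)\<close>, and \<open>W(X) = (a - b)\<^bsup>dim X\<^esup>\<close>.
  Sorting flags by their smallest face shows that \<open>\<Psi>(X)\<close> is the sum of \<open>W(F)\<close> over the nonempty
  faces. A hyperplane \<open>H\<close> containing no vertex of \<open>X\<close> induces an isomorphism from the faces of \<open>X\<close>
  meeting \<open>H\<close> to the nonempty faces of \<open>X \<inter> H\<close>, so the weight of \<open>F \<inter> H\<close> is \<open>W(F)\<close> with one
  factor \<open>a - b\<close> removed; this covers both the vertex figures and the slices of the sweep.

  By induction on the dimension, the sum of \<open>\<Phi>\<^sub>v(X)\<close> over the vertices above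
  \<open>H = {p \<bullet> x = t}\<close> is \<open>\<Sum>W(F) - a \<Psi>(X \<inter> H)\<close>, where \<open>F\<close> ranges over the faces with a point above
  \<open>H\<close>. Indeed, applying the induction hypothesis to \<open>Q\<^sub>v\<close> and \<open>H\<^sub>v\<close> turns the recursion for \<open>\<Phi>\<^sub>v(X)\<close>
  into the change of this expression as \<open>t\<close> descends past \<open>p \<bullet> v\<close>: the faces with top vertex \<open>v\<close> enter the
  sum, and the slice loses the faces with bottom vertex \<open>v\<close> and gains those with top vertex \<open>v\<close>.
  Moving \<open>H\<close> below \<open>X\<close> gives the theorem. The slices \<open>R\<^sub>v\<close> have a cd-index because the same
  argument applies to them, with vertex figures and a generic direction of their own.
\<close>

section \<open>Substitution into noncommutative polynomials\<close>

lemma poly_mapping_sum_single: "f =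
    (\<Sum>u\<in>Poly_Mapping.keys f. Poly_Mapping.single u (Poly_Mapping.lookup f u))"
proof (rule poly_mapping_eqI)
  fix k
  have "(\<Sum>u\<in>Poly_Mapping.keys f. Poly_Mapping.lookup (Poly_Mapping.single u (Poly_Mapping.lookup f u)) k)
      = (\<Sum>u\<in>Poly_Mapping.keys f. if u = k then Poly_Mapping.lookup f u else 0)"
    by (intro sum.cong) (auto simp: lookup_single when_def)
  also have "\<dots> = Poly_Mapping.lookup f k"
    by (simp add: sum.delta in_keys_iff)
  finally show "Poly_Mapping.lookup f k =
      Poly_Mapping.lookup (\<Sum>u\<in>Poly_Mapping.keys f. Poly_Mapping.single u (Poly_Mapping.lookup f u)) k"
    by (simp add: lookup_sum)
qed

lemma ncsubst_superset:
  assumes "finite A" "Poly_Mapping.keys f \<subseteq> A"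
  shows "ncsubst \<sigma> f = (\<Sum>u\<in>A. of_int (Poly_Mapping.lookup f u) * prod_list (map \<sigma> (letters u)))"
  unfolding ncsubst_def using assms by (intro sum.mono_neutral_left) (auto simp: in_keys_iff)

lemma ncsubst_add: "ncsubst \<sigma> (f + g) = ncsubst \<sigma> f + ncsubst \<sigma> g"
proof -
  let ?A = "Poly_Mapping.keys f \<union> Poly_Mapping.keys g"
  have "Poly_Mapping.keys (f + g) \<subseteq> ?A"
    by (rule Poly_Mapping.keys_add)
  then show ?thesis
    by (simp add: ncsubst_superset[of ?A] lookup_add distrib_right sum.distrib)
qed

lemma ncsubst_0 [simp]: "ncsubst \<sigma> 0 = 0"
  by (simp add: ncsubst_def)

lemma ncsubst_minus: "ncsubst \<sigma> (f - g) = ncsubst \<sigma> f - ncsubst \<sigma> g"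
  using ncsubst_add[of \<sigma> "f - g" g] by (simp add: algebra_simps)

lemma ncsubst_sum: "ncsubst \<sigma> (\<Sum>i\<in>I. f i) = (\<Sum>i\<in>I. ncsubst \<sigma> (f i))"
  by (induction I rule: infinite_finite_induct) (simp_all add: ncsubst_add)

lemma ncsubst_single:
  "ncsubst \<sigma> (Poly_Mapping.single u k) = of_int k * prod_list (map \<sigma> (letters u))"
  by (cases "k = 0") (simp_all add: ncsubst_def)

lemma ncsubst_of_int [simp]:
  fixes \<sigma> :: "'x \<Rightarrow> 'y ncpoly"
  shows "ncsubst \<sigma> (of_int k) = of_int k"
proof -
  have "of_int k = Poly_Mapping.single (0 :: 'x free_word) k"
    by (metis of_int_eq_id id_apply single_of_int)
  moreover have "ncsubst \<sigma> (Poly_Mapping.single (0 :: 'x free_word) k) = of_int k"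
    by (simp add: ncsubst_single zero_free_word_def)
  ultimately show ?thesis by simp
qed

lemma ncsubst_1 [simp]: "ncsubst \<sigma> 1 = 1"
  using ncsubst_of_int[of \<sigma> 1] by simp

text \<open>Integer coefficients are central, so they move past the image of \<open>x\<close>. Left
  multiplication by one variable is the only product to be substituted, because the sweep recursion
  multiplies by \<open>c\<close> and \<open>d\<close> on the left.\<close>

lemma ncsubst_var_mult: "ncsubst \<sigma> (ncvar x * f) = \<sigma> x * ncsubst \<sigma> f"
proof -
  have "ncvar x * f = (\<Sum>u\<in>Poly_Mapping.keys f. Poly_Mapping.single (Word [x] + u) (Poly_Mapping.lookup f u))"
    using arg_cong[OF poly_mapping_sum_single[of f], of "\<lambda>g. ncvar x * g"]
    by (simp only: ncvar_def sum_distrib_left mult_single mult_1_left)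
  then have "ncsubst \<sigma> (ncvar x * f) = (\<Sum>u\<in>Poly_Mapping.keys f.
      of_int (Poly_Mapping.lookup f u) * (\<sigma> x * prod_list (map \<sigma> (letters u))))"
    by (simp add: ncsubst_sum ncsubst_single plus_free_word_def)
  also have "\<dots> = \<sigma> x * ncsubst \<sigma> f"
    unfolding ncsubst_def sum_distrib_left
    by (intro sum.cong refl) (metis mult.assoc mult_of_int_commute)
  finally show ?thesis .
qed

section \<open>Left quotients and injectivity of the substitution\<close>

lift_definition left_quot :: "'x \<Rightarrow> 'x ncpoly \<Rightarrow> 'x ncpoly" is
  "\<lambda>x f u. f (Word (x # letters u))"
proof -
  fix x :: 'x and f :: "'x free_word \<Rightarrow> int"
  assume "finite {u. f u \<noteq> 0}"
  then have "finite ((\<lambda>u. Word (x # letters u)) -` {u. f u \<noteq> 0})"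
    by (rule finite_vimageI) (auto simp: inj_def free_word.expand)
  then show "finite {u. f (Word (x # letters u)) \<noteq> 0}"
    by (simp add: vimage_def)
qed

lemma lookup_var_mult:
  "Poly_Mapping.lookup (ncvar x * f) (Word l) =
    (case l of [] \<Rightarrow> 0 | y # m \<Rightarrow> if x = y then Poly_Mapping.lookup f (Word m) else 0)"
proof -
  have eq: "Word [x] + u = Word l \<longleftrightarrow> (\<exists>m. l = x # m \<and> u = Word m)" for u
    by (cases u) (auto simp: plus_free_word_def)
  have "ncvar x * f = (\<Sum>u\<in>Poly_Mapping.keys f. Poly_Mapping.single (Word [x] + u) (Poly_Mapping.lookup f u))"
    using arg_cong[OF poly_mapping_sum_single[of f], of "\<lambda>g. ncvar x * g"]
    by (simp only: ncvar_def sum_distrib_left mult_single mult_1_left)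
  then have "Poly_Mapping.lookup (ncvar x * f) (Word l) =
      (\<Sum>u\<in>Poly_Mapping.keys f. if Word [x] + u = Word l then Poly_Mapping.lookup f u else 0)"
    by (simp add: lookup_sum lookup_single when_def)
  also have "\<dots> = (case l of [] \<Rightarrow> 0 | y # m \<Rightarrow> if x = y then Poly_Mapping.lookup f (Word m) else 0)"
    unfolding eq by (auto split: list.split simp: in_keys_iff)
  finally show ?thesis .
qed

lemma left_quot_add: "left_quot x (f + g) = left_quot x f + left_quot x g"
  by transfer simp

lemma left_quot_0 [simp]: "left_quot x 0 = 0"
  by transfer simp

lemma left_quot_of_int [simp]: "left_quot x (of_int k) = 0"
  by (rule poly_mapping_eqI)
    (simp add: left_quot.rep_eq lookup_of_int when_def zero_free_word_def)

text \<open>Makes a leading variable cancellable, and separates words with different first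
  letters.\<close>

lemma left_quot_var_mult: "left_quot x (ncvar y * f) = (if x = y then f else 0)"
proof (rule poly_mapping_eqI)
  fix u
  show "Poly_Mapping.lookup (left_quot x (ncvar y * f)) u = Poly_Mapping.lookup (if x = y then f else 0) u"
    by (simp add: left_quot.rep_eq lookup_var_mult)
qed

lemma cd_decomp:
  "f = of_int (Poly_Mapping.lookup f 0) + ncvar letter_c * left_quot letter_c f + ncvar letter_d * left_quot letter_d f"
proof (rule poly_mapping_eqI)
  fix u :: "cd free_word"
  obtain l where u: "u = Word l" by (cases u)
  show "Poly_Mapping.lookup f u = Poly_Mapping.lookup (of_int (Poly_Mapping.lookup f 0)
      + ncvar letter_c * left_quot letter_c f + ncvar letter_d * left_quot letter_d f) u"
  proof (cases l)
    case Nil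
    then show ?thesis by (simp add: u lookup_add lookup_var_mult lookup_of_int zero_free_word_def)
  next
    case (Cons x m)
    then show ?thesis
      by (cases x) (simp_all add: u lookup_add lookup_var_mult lookup_of_int zero_free_word_def left_quot.rep_eq)
  qed
qed

text \<open>With \<open>f = k + c f1 + d f2\<close>, the substitution yields
  \<open>k + a (g1 + b g2) + b (g1 + a g2)\<close>. Sorting by first letter, both brackets vanish,
  hence \<open>a g2 = b g2\<close>. No word begins with both letters, so \<open>g2 = 0\<close> and
  then \<open>g1 = 0\<close>; the induction on the word length removes \<open>f1\<close> and
  \<open>f2\<close>.\<close>

lemma cd_subst_eq_0:
  assumes "\<And>u. u \<in> Poly_Mapping.keys f \<Longrightarrow> length (letters u) < n" and "ncsubst cd_to_ab f = 0"
  shows "f = 0"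
  using assms
proof (induction n arbitrary: f)
  case 0
  then have "Poly_Mapping.keys f = {}" by blast
  then show ?case by simp
next
  case (Suc n)
  let ?a = "ncvar letter_a" and ?b = "ncvar letter_b"
  define k where "k = Poly_Mapping.lookup f 0"
  define f1 where "f1 = left_quot letter_c f"
  define f2 where "f2 = left_quot letter_d f"
  define g1 where "g1 = ncsubst cd_to_ab f1"
  define g2 where "g2 = ncsubst cd_to_ab f2"
  have f: "f = of_int k + ncvar letter_c * f1 + ncvar letter_d * f2"
    unfolding k_def f1_def f2_def by (rule cd_decomp)
  have "length (letters u) < n" if "u \<in> Poly_Mapping.keys (left_quot x f)" for u x
    using Suc.prems(1)[of "Word (x # letters u)"] that by (simp add: in_keys_iff left_quot.rep_eq)
  then have small: "g1 = 0 \<Longrightarrow> f1 = 0" "g2 = 0 \<Longrightarrow> f2 = 0"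
    unfolding g1_def g2_def f1_def f2_def using Suc.IH by blast+
  have eq: "of_int k + ?a * (g1 + ?b * g2) + ?b * (g1 + ?a * g2) = 0"
    using Suc.prems(2) by (subst (asm) f)
      (simp add: ncsubst_add ncsubst_var_mult g1_def g2_def algebra_simps)
  have 1: "g1 + ?b * g2 = 0"
    using arg_cong[OF eq, of "left_quot letter_a"] by (simp add: left_quot_add left_quot_var_mult)
  have 2: "g1 + ?a * g2 = 0"
    using arg_cong[OF eq, of "left_quot letter_b"] by (simp add: left_quot_add left_quot_var_mult)
  have "?a * g2 = ?b * g2"
    using 1 2 by (metis add_left_imp_eq)
  then have "g2 = 0"
    using left_quot_var_mult[of letter_a letter_a g2] left_quot_var_mult[of letter_a letter_b g2] by simp
  then have "g1 = 0" using 1 by simp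
  have "f = of_int k" using f small \<open>g1 = 0\<close> \<open>g2 = 0\<close> by simp
  moreover have "of_int k = (0 :: ab ncpoly)"
    using eq \<open>g1 = 0\<close> \<open>g2 = 0\<close> by simp
  ultimately show ?case by simp
qed

lemma cd_subst_inj: "inj (ncsubst cd_to_ab)"
proof (rule injI)
  fix f g :: "cd ncpoly"
  assume "ncsubst cd_to_ab f = ncsubst cd_to_ab g"
  then have 0: "ncsubst cd_to_ab (f - g) = 0" by (simp add: ncsubst_minus)
  let ?N = "Suc (Max ((\<lambda>u. length (letters u)) ` Poly_Mapping.keys (f - g)))"
  have "length (letters u) < ?N" if "u \<in> Poly_Mapping.keys (f - g)" for u
    using that by (simp add: less_Suc_eq_le)
  then have "f - g = 0" using 0 by (rule cd_subst_eq_0)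
  then show "f = g" by simp
qed

text \<open>Injectivity turns any preimage of the ab-index into the value of the definite
  description in \<open>cd_index\<close>.\<close>

lemma cd_index_eqI:
  assumes "P \<noteq> {}" "ncsubst cd_to_ab \<Phi> = ab_index P"
  shows "cd_index P = \<Phi>"
  unfolding cd_index_def if_not_P[OF assms(1)]
proof (rule the_equality)
  fix \<Phi>' assume "ncsubst cd_to_ab \<Phi>' = ab_index P"
  then show "\<Phi>' = \<Phi>" using assms(2) injD[OF cd_subst_inj] by metis
qed (rule assms(2))

section \<open>The ab-index as a sum over faces\<close>

abbreviation "va \<equiv> (ncvar letter_a :: ab ncpoly)"
abbreviation "vb \<equiv> (ncvar letter_b :: ab ncpoly)"

text \<open>For a strictly increasing list of ranks in \<open>k\<close>, ..., \<open>n - 1\<close>,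
  this is the product over these ranks with \<open>b\<close> at the listed ones and
  \<open>a - b\<close> at the others. Recursion on the list follows a chain of faces upward.\<close>

primrec chain_weight :: "nat \<Rightarrow> nat \<Rightarrow> nat list \<Rightarrow> ab ncpoly" where
  "chain_weight n k [] = (va - vb) ^ (n - k)"
| "chain_weight n k (i # l) = (va - vb) ^ (i - k) * (vb * chain_weight n (Suc i) l)"

lemma prod_list_const:
  fixes x :: "'a::monoid_mult"
  assumes "\<And>i. i \<in> set l \<Longrightarrow> f i = x"
  shows "prod_list (map f l) = x ^ length l"
  using assms by (induction l) auto

lemma prod_list_eq_chain_weight:
  assumes "sorted_wrt (<) l" "set l \<subseteq> {k..<n}" "k \<le> n"
  shows "prod_list (map (\<lambda>i. if i \<in> set l then vb else va - vb) [k..<n]) = chain_weight n k l"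
  using assms
proof (induction l arbitrary: k)
  case Nil
  then show ?case using prod_list_const[of "[k..<n]" "\<lambda>i. va - vb" "va - vb"] by simp
next
  case (Cons i l)
  have i: "k \<le> i" "i < n" "i \<notin> set l" "\<forall>j\<in>set l. i < j" using Cons.prems by auto
  have split: "[k..<n] = [k..<i] @ i # [Suc i..<n]"
    using i upt_add_eq_append[of k i "n - i"] by (simp add: upt_conv_Cons)
  have 1: "prod_list (map (\<lambda>j. if j \<in> set (i # l) then vb else va - vb) [k..<i]) = (va - vb) ^ (i - k)"
    using i by (subst prod_list_const[of _ _ "va - vb"]) auto
  have 2: "map (\<lambda>j. if j \<in> set (i # l) then vb else va - vb) [Suc i..<n]
      = map (\<lambda>j. if j \<in> set l then vb else va - vb) [Suc i..<n]"
    by simp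
  have 3: "prod_list (map (\<lambda>j. if j \<in> set l then vb else va - vb) [Suc i..<n]) = chain_weight n (Suc i) l"
    using Cons.prems i by (intro Cons.IH) (auto simp: Suc_le_eq)
  show ?case
    unfolding split map_append prod_list.append 1 list.map(2) prod_list.Cons 2 3
    by simp
qed

text \<open>Expanding the product, each position outside \<open>T\<close> chooses \<open>a\<close>,
  or \<open>b\<close> with a sign, and the choices of \<open>b\<close> there form
  \<open>S - T\<close>. \<open>T\<close> need not lie below \<open>n\<close>, so it stays fixed
  while \<open>n\<close> grows.\<close>

lemma alternating_ab_word_sum:
  "(\<Sum>S\<in>{S \<in> Pow {..<n}. T \<inter> {..<n} \<subseteq> S}. (- 1) ^ card (S - T) * ab_word n S)
    = prod_list (map (\<lambda>i. if i \<in> T then vb else va - vb) [0..<n])"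
proof (induction n)
  case 0
  have "{S \<in> Pow {..<0::nat}. T \<inter> {..<0} \<subseteq> S} = {{}}" by auto
  then show ?case by (simp add: ab_word_def)
next
  case (Suc n)
  let ?A = "{S \<in> Pow {..<n}. T \<inter> {..<n} \<subseteq> S}"
  let ?A' = "{S \<in> Pow {..<Suc n}. T \<inter> {..<Suc n} \<subseteq> S}"
  let ?f = "\<lambda>n S. (- 1) ^ card (S - T) * ab_word n S"
  have fin: "finite ?A" by simp
  have lt: "n \<notin> S" if "S \<in> ?A" for S using that by auto
  have w1: "ab_word (Suc n) S = ab_word n S * va" if "S \<in> ?A" for S
    using lt[OF that] by (simp add: ab_word_def)
  have w2: "ab_word (Suc n) (insert n S) = ab_word n S * vb" if "S \<in> ?A" for S
  proof -
    have "map (\<lambda>i. if i \<in> insert n S then vb else va) [0..<n] = map (\<lambda>i. if i \<in> S then vb else va) [0..<n]"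
      by simp
    moreover have "ab_word (Suc n) (insert n S)
        = prod_list (map (\<lambda>i. if i \<in> insert n S then vb else va) [0..<n]) * vb"
      by (simp add: ab_word_def)
    ultimately show ?thesis by (simp only: ab_word_def)
  qed
  have c2: "card (insert n S - T) = (if n \<in> T then card (S - T) else Suc (card (S - T)))" if "S \<in> ?A" for S
  proof -
    have "finite S" using that finite_subset by auto
    then show ?thesis using lt[OF that] by (auto simp: insert_Diff_if)
  qed
  have inj: "inj_on (insert n) ?A"
    by (rule inj_onI) (metis lt Diff_insert_absorb)
  have sum2: "(\<Sum>S\<in>insert n ` ?A. ?f (Suc n) S) = (if n \<in> T then 1 else - 1) * (\<Sum>S\<in>?A. ?f n S) * vb"
    unfolding sum.reindex[OF inj] o_def
    by (subst sum_distrib_left, subst sum_distrib_right, intro sum.cong refl)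
      (simp add: w2 c2 mult.assoc)
  have sum1: "(\<Sum>S\<in>?A. ?f (Suc n) S) = (\<Sum>S\<in>?A. ?f n S) * va"
    by (subst sum_distrib_right, intro sum.cong refl) (simp add: w1 mult.assoc)
  have pow: "S \<in> insert n ` ?A" if "S \<in> ?A'" "n \<in> S" for S
    using that by (intro image_eqI[of _ _ "S - {n}"]) (auto simp: less_Suc_eq)
  show ?case
  proof (cases "n \<in> T")
    case True
    have "?A' = insert n ` ?A" using True pow by (auto simp: less_Suc_eq)
    then have "(\<Sum>S\<in>?A'. ?f (Suc n) S) = (\<Sum>S\<in>?A. ?f n S) * vb"
      using sum2 True by simp
    then show ?thesis using Suc True by simp
  next
    case False
    have "?A' = ?A \<union> insert n ` ?A"
    proof (intro equalityI subsetI)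
      fix S assume "S \<in> ?A'"
      then show "S \<in> ?A \<union> insert n ` ?A"
        using pow[of S] by (cases "n \<in> S") (auto simp: less_Suc_eq)
    qed (use False in \<open>auto simp: less_Suc_eq\<close>)
    moreover have "?A \<inter> insert n ` ?A = {}" using lt by auto
    ultimately have "(\<Sum>S\<in>?A'. ?f (Suc n) S) = (\<Sum>S\<in>?A. ?f n S) * va - (\<Sum>S\<in>?A. ?f n S) * vb"
      using sum1 sum2 False fin by (simp add: sum.union_disjoint)
    then show ?thesis using Suc False by (simp add: algebra_simps)
  qed
qed

text \<open>Exchanging the sums over \<open>T \<subseteq> S\<close> leaves, for each
  \<open>T\<close>, an alternating sum of words that collapses to one product in \<open>b\<close>
  and \<open>a - b\<close>.\<close>

lemma ab_index_flag_f:
  assumes "n = nat (aff_dim P)"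
  shows "ab_index P = (\<Sum>T\<in>Pow {..<n}. of_nat (flag_f P T) * chain_weight n 0 (sorted_list_of_set T))"
proof -
  let ?g = "\<lambda>T S. of_nat (flag_f P T) * ((- 1) ^ card (S - T) * ab_word n S)"
  have "of_int (flag_h P S) * ab_word n S = (\<Sum>T\<in>{T \<in> Pow {..<n}. T \<subseteq> S}. ?g T S)" if "S \<in> Pow {..<n}" for S
  proof -
    have fin: "finite S" using that finite_subset by auto
    have S: "{T \<in> Pow {..<n}. T \<subseteq> S} = Pow S" using that by auto
    have "of_int ((- 1) ^ (card S - card T) * int (flag_f P T)) * ab_word n S = ?g T S" if "T \<in> Pow S" for T
    proof -
      have c: "card S - card T = card (S - T)"
        using that fin by (metis Pow_iff card_Diff_subset finite_subset)
      have "of_int ((- 1) ^ (card S - card T) * int (flag_f P T)) * ab_word n S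
          = of_nat (flag_f P T) * of_int ((- 1) ^ card (S - T)) * ab_word n S"
        unfolding c by (simp only: mult.commute[of "(- 1) ^ _"] of_int_mult of_int_of_nat_eq)
      then show ?thesis by (simp add: mult.assoc)
    qed
    then show ?thesis
      unfolding S flag_h_def of_int_sum sum_distrib_right by (rule sum.cong[OF refl])
  qed
  then have "ab_index P = (\<Sum>S\<in>Pow {..<n}. \<Sum>T\<in>{T \<in> Pow {..<n}. T \<subseteq> S}. ?g T S)"
    by (simp add: ab_index_def Let_def assms)
  also have "\<dots> = (\<Sum>T\<in>Pow {..<n}. \<Sum>S\<in>{S \<in> Pow {..<n}. T \<subseteq> S}. ?g T S)"
    by (rule sum.swap_restrict) auto
  also have "\<dots> = (\<Sum>T\<in>Pow {..<n}. of_nat (flag_f P T) * chain_weight n 0 (sorted_list_of_set T))"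
  proof (intro sum.cong refl)
    fix T assume T: "T \<in> Pow {..<n}"
    then have fin: "finite T" and "T \<inter> {..<n} = T" using finite_subset by auto
    then have "(\<Sum>S\<in>{S \<in> Pow {..<n}. T \<subseteq> S}. ?g T S)
        = of_nat (flag_f P T) * prod_list (map (\<lambda>i. if i \<in> T then vb else va - vb) [0..<n])"
      using alternating_ab_word_sum[of T n] by (simp add: sum_distrib_left[symmetric])
    also have "prod_list (map (\<lambda>i. if i \<in> T then vb else va - vb) [0..<n]) = chain_weight n 0 (sorted_list_of_set T)"
      using prod_list_eq_chain_weight[of "sorted_list_of_set T" 0 n] T fin
      by (simp add: atLeast0LessThan)
    finally show "(\<Sum>S\<in>{S \<in> Pow {..<n}. T \<subseteq> S}. ?g T S)
        = of_nat (flag_f P T) * chain_weight n 0 (sorted_list_of_set T)" .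
  qed
  finally show ?thesis .
qed

section \<open>Chains of proper faces above a given face\<close>

definition chains_above :: "'a::euclidean_space set \<Rightarrow> 'a set \<Rightarrow> 'a set list set" where
  "chains_above X F = {L. (\<forall>G\<in>set L. G face_of X \<and> G \<noteq> X) \<and> sorted_wrt (\<subset>) (F # L)}"

definition chain_sum :: "'a::euclidean_space set \<Rightarrow> 'a set \<Rightarrow> ab ncpoly" where
  "chain_sum X F = (\<Sum>L\<in>chains_above X F.
    chain_weight (nat (aff_dim X)) (nat (aff_dim F + 1)) (map (\<lambda>G. nat (aff_dim G)) L))"

text \<open>For a face \<open>F \<noteq> X\<close>, \<open>chain_sum X F\<close> is the ab-index of the quotient polytope \<open>X/F\<close>.\<close>

definition up_weight :: "'a::euclidean_space set \<Rightarrow> 'a set \<Rightarrow> ab ncpoly" where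
  "up_weight X F = (if F = X then 1 else vb * chain_sum X F)"

definition face_weight :: "'a::euclidean_space set \<Rightarrow> 'a set \<Rightarrow> ab ncpoly" where
  "face_weight X F = (va - vb) ^ nat (aff_dim F) * up_weight X F"

lemma aff_dim_nonneg_iff:
  fixes S :: "'a::euclidean_space set"
  shows "aff_dim S \<ge> 0 \<longleftrightarrow> S \<noteq> {}"
  using aff_dim_geq[of S] aff_dim_empty[of S] by linarith

lemma sorted_wrt_psubset_distinct: "sorted_wrt (\<subset>) L \<Longrightarrow> distinct L"
  by (induction L) auto

lemma finite_chains_above:
  assumes "polytope X"
  shows "finite (chains_above X F)"
proof (rule finite_subset)
  show "chains_above X F \<subseteq> {L. set L \<subseteq> {G. G face_of X} \<and> distinct L}"
    using sorted_wrt_psubset_distinct by (fastforce simp: chains_above_def)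
qed (use finite_polytope_faces[OF assms] in \<open>rule finite_subset_distinct\<close>)

text \<open>Splits off the first face of a chain. For \<open>F = {}\<close> the chains consist of
  nonempty proper faces, since each member strictly contains \<open>{}\<close>.\<close>

lemma chains_above_rec:
  "chains_above X F = insert [] (\<Union>G\<in>{G. G face_of X \<and> G \<noteq> X \<and> F \<subset> G}. (#) G ` chains_above X G)"
  (is "_ = ?R")
proof (intro equalityI subsetI)
  fix L assume "L \<in> chains_above X F"
  then show "L \<in> ?R"
    by (cases L) (auto simp: chains_above_def)
next
  fix L assume "L \<in> ?R"
  then consider "L = []"
    | G M where "L = G # M" "G face_of X" "G \<noteq> X" "F \<subset> G" "M \<in> chains_above X G" by blast
  then show "L \<in> chains_above X F"
  proof cases
    case (2 G M)
    then have "\<forall>H\<in>set M. F \<subset> H" by (simp add: chains_above_def) (meson psubset_trans)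
    with 2 show ?thesis by (simp add: chains_above_def)
  qed (simp add: chains_above_def)
qed

text \<open>Sort the chains by their first face \<open>G\<close>. The exponent counts the dimensions
  strictly between those of \<open>F\<close> and \<open>G\<close>; this covers
  \<open>F = {}\<close>, whose dimension is -1.\<close>

lemma chain_sum_rec:
  assumes X: "polytope X" and F: "F face_of X" "F \<noteq> X"
  shows "chain_sum X F =
    (\<Sum>G | G face_of X \<and> F \<subset> G. (va - vb) ^ nat (aff_dim G - aff_dim F - 1) * up_weight X G)"
proof -
  let ?n = "nat (aff_dim X)"
  let ?w = "\<lambda>F L. chain_weight ?n (nat (aff_dim F + 1)) (map (\<lambda>G. nat (aff_dim G)) L)"
  let ?G = "{G. G face_of X \<and> G \<noteq> X \<and> F \<subset> G}"
  have fin: "finite {G. G face_of X}" using X by (rule finite_polytope_faces)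
  have finG: "finite ?G" by (rule finite_subset[OF _ fin]) auto
  have expo: "nat (aff_dim G) - nat (aff_dim F + 1) = nat (aff_dim G - aff_dim F - 1)" if "F \<subset> G" for G
  proof -
    have "G \<noteq> {}" using that by auto
    then have "aff_dim G \<ge> 0" by (simp add: aff_dim_nonneg_iff)
    moreover have "aff_dim F + 1 \<ge> 0" using aff_dim_geq[of F] by simp
    ultimately show ?thesis by (simp add: nat_diff_distrib' algebra_simps)
  qed
  have fin1: "finite (\<Union>G\<in>?G. (#) G ` chains_above X G)"
    using finG finite_chains_above[OF X] by simp
  have "chain_sum X F = ?w F [] + (\<Sum>L\<in>(\<Union>G\<in>?G. (#) G ` chains_above X G). ?w F L)"
    unfolding chain_sum_def chains_above_rec[of X F] using fin1 by (subst sum.insert) auto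
  also have "(\<Sum>L\<in>(\<Union>G\<in>?G. (#) G ` chains_above X G). ?w F L)
      = (\<Sum>G\<in>?G. \<Sum>L\<in>(#) G ` chains_above X G. ?w F L)"
    using finG finite_chains_above[OF X] by (subst sum.UNION_disjoint) auto
  also have "\<dots> = (\<Sum>G\<in>?G. (va - vb) ^ nat (aff_dim G - aff_dim F - 1) * up_weight X G)"
  proof (intro sum.cong refl)
    fix G assume G: "G \<in> ?G"
    then have "aff_dim G \<ge> 0" by (auto simp: aff_dim_nonneg_iff)
    then have S: "Suc (nat (aff_dim G)) = nat (aff_dim G + 1)" by simp
    have "(\<Sum>L\<in>(#) G ` chains_above X G. ?w F L) = (\<Sum>L\<in>chains_above X G. ?w F (G # L))"
      by (subst sum.reindex) auto
    also have "\<dots> = (va - vb) ^ nat (aff_dim G - aff_dim F - 1) * (vb * chain_sum X G)"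
      using G by (simp add: chain_sum_def expo S sum_distrib_left)
    finally show "(\<Sum>L\<in>(#) G ` chains_above X G. ?w F L)
        = (va - vb) ^ nat (aff_dim G - aff_dim F - 1) * up_weight X G"
      using G by (simp add: up_weight_def)
  qed
  \<comment> \<open>The empty chain supplies the summand for \<open>G = X\<close>.\<close>
  also have "?w F [] = (va - vb) ^ nat (aff_dim X - aff_dim F - 1) * up_weight X X"
    using expo[of X] face_of_imp_subset[OF F(1)] F(2) by (simp add: up_weight_def psubset_eq)
  also have "\<dots> + (\<Sum>G\<in>?G. (va - vb) ^ nat (aff_dim G - aff_dim F - 1) * up_weight X G)
      = (\<Sum>G\<in>insert X ?G. (va - vb) ^ nat (aff_dim G - aff_dim F - 1) * up_weight X G)"
    using finG by simp
  also have "insert X ?G = {G. G face_of X \<and> F \<subset> G}"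
    using F face_of_imp_subset face_of_refl[OF polytope_imp_convex[OF X]] by blast
  finally show ?thesis .
qed

text \<open>Dimensions increase strictly along a chain of faces, so a chain of nonempty proper faces
  has a rank set \<open>T\<close> below \<open>n\<close>, and the chains with rank set
  \<open>T\<close> are exactly the \<open>T\<close>-chains counted by \<open>flag_f\<close>.\<close>

lemma ab_index_eq_chain_sum:
  assumes X: "polytope X" "X \<noteq> {}"
  shows "ab_index X = chain_sum X {}"
proof -
  define n where "n = nat (aff_dim X)"
  have n: "aff_dim X = int n" using X by (simp add: n_def aff_dim_nonneg_iff)
  let ?dims = "map (\<lambda>G. nat (aff_dim G))"
  let ?T = "\<lambda>L. set (?dims L)"
  have fin: "finite (chains_above X {})" using X(1) by (rule finite_chains_above)
  have sorted: "sorted_wrt (<) (?dims L) \<and> ?T L \<subseteq> {..<n} \<and> map aff_dim L = map int (?dims L)"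
    if "L \<in> chains_above X {}" for L
  proof (intro conjI)
    have L: "\<forall>G\<in>set L. G face_of X \<and> G \<noteq> X \<and> G \<noteq> {}" "sorted_wrt (\<subset>) L"
      using that by (auto simp: chains_above_def)
    have lt: "aff_dim F < aff_dim G" if "F \<in> set L" "G \<in> set L" "F \<subset> G" for F G
    proof -
      have "F face_of G" using L(1) that by (meson face_of_imp_subset face_of_subset psubset_imp_subset)
      then show ?thesis using L(1) that by (metis face_of_aff_dim_lt face_of_imp_convex order_less_irrefl)
    qed
    show "sorted_wrt (<) (?dims L)"
      unfolding sorted_wrt_map
    proof (rule sorted_wrt_mono_rel[OF _ L(2)])
      fix F G assume "F \<in> set L" "G \<in> set L" "F \<subset> G"
      moreover have "aff_dim F \<ge> 0" using L(1) \<open>F \<in> set L\<close> by (auto simp: aff_dim_nonneg_iff)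
      ultimately show "nat (aff_dim F) < nat (aff_dim G)" using lt[of F G] by simp
    qed
    show "?T L \<subseteq> {..<n}"
    proof
      fix i assume "i \<in> ?T L"
      then obtain G where G: "G \<in> set L" "i = nat (aff_dim G)" by auto
      then have "aff_dim G < aff_dim X" "aff_dim G \<ge> 0"
        using L(1) X(1) by (auto simp: face_of_aff_dim_lt polytope_imp_convex aff_dim_nonneg_iff)
      then show "i \<in> {..<n}" using G n by simp
    qed
    show "map aff_dim L = map int (?dims L)"
      using L(1) by (auto simp: aff_dim_nonneg_iff)
  qed
  have group: "S_chains X T = {L \<in> chains_above X {}. ?T L = T}" if T: "T \<in> Pow {..<n}" for T
  proof (intro equalityI subsetI)
    fix L assume "L \<in> S_chains X T"
    then have L: "\<forall>F\<in>set L. F face_of X" "sorted_wrt (\<subset>) L" "map aff_dim L = map int (sorted_list_of_set T)"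
      by (auto simp: S_chains_def)
    have finT: "finite T" using T finite_subset by auto
    have "?dims L = map nat (map aff_dim L)" by simp
    also have "\<dots> = sorted_list_of_set T" unfolding L(3) by (simp add: comp_def)
    finally have dims: "?dims L = sorted_list_of_set T" .
    \<comment> \<open>Dimensions from 0 to \<open>n - 1\<close> exclude both the empty face and
      \<open>X\<close>.\<close>
    have "G \<noteq> X \<and> G \<noteq> {}" if "G \<in> set L" for G
    proof -
      have "aff_dim G \<in> set (map int (sorted_list_of_set T))" using that L(3)
        by (metis image_eqI list.set_map)
      then have "0 \<le> aff_dim G" "aff_dim G < int n" using T finT by auto
      then show ?thesis using n by auto
    qed
    then show "L \<in> {L \<in> chains_above X {}. ?T L = T}"
      using L dims finT by (auto simp: chains_above_def simp del: set_map)
  next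
    fix L assume L: "L \<in> {L \<in> chains_above X {}. ?T L = T}"
    have "distinct (?dims L)" "sorted (?dims L)"
      using sorted[of L] L strict_sorted_iff by blast+
    then have "?dims L = sorted_list_of_set T"
      using L by (metis (mono_tags, lifting) mem_Collect_eq sorted_list_of_set.idem_if_sorted_distinct)
    then show "L \<in> S_chains X T"
      using L sorted[of L] by (auto simp: S_chains_def chains_above_def)
  qed
  have "ab_index X = (\<Sum>T\<in>Pow {..<n}. of_nat (flag_f X T) * chain_weight n 0 (sorted_list_of_set T))"
    by (rule ab_index_flag_f[OF n_def])
  also have "\<dots> = (\<Sum>T\<in>Pow {..<n}. \<Sum>L\<in>{L \<in> chains_above X {}. ?T L = T}. chain_weight n 0 (?dims L))"
  proof (intro sum.cong refl)
    fix T assume T: "T \<in> Pow {..<n}"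
    have "chain_weight n 0 (?dims L) = chain_weight n 0 (sorted_list_of_set T)"
      if "L \<in> {L \<in> chains_above X {}. ?T L = T}" for L
    proof -
      have "distinct (?dims L)" "sorted (?dims L)"
        using sorted[of L] that strict_sorted_iff by blast+
      then have "?dims L = sorted_list_of_set T"
        using that by (metis (mono_tags, lifting) mem_Collect_eq sorted_list_of_set.idem_if_sorted_distinct)
      then show ?thesis by simp
    qed
    then show "of_nat (flag_f X T) * chain_weight n 0 (sorted_list_of_set T)
        = (\<Sum>L\<in>{L \<in> chains_above X {}. ?T L = T}. chain_weight n 0 (?dims L))"
      by (simp add: flag_f_def group[OF T])
  qed
  also have "\<dots> = (\<Sum>L\<in>chains_above X {}. chain_weight n 0 (?dims L))"
    by (rule sum.group) (use fin sorted in auto)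
  finally show ?thesis
    by (simp add: chain_sum_def n_def)
qed

text \<open>This is \<open>chain_sum_rec\<close> at the empty face: its dimension -1 makes the
  exponent equal to the dimension of \<open>G\<close>.\<close>

lemma ab_index_eq_face_weights:
  assumes X: "polytope X" "X \<noteq> {}"
  shows "ab_index X = (\<Sum>F | F face_of X \<and> F \<noteq> {}. face_weight X F)"
proof -
  have "{G. G face_of X \<and> {} \<subset> G} = {F. F face_of X \<and> F \<noteq> {}}" by auto
  then show ?thesis
    using X by (simp add: ab_index_eq_chain_sum chain_sum_rec face_weight_def)
qed

section \<open>Hyperplane sections of polytopes\<close>

text \<open>The relative interior is dense in \<open>S\<close>, so it has points on both sides of
  the hyperplane and, being connected, meets it. The section then contains a nonempty relatively
  open part of the affine hull cut by the hyperplane, and so has the same dimension as that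
  cut.\<close>

lemma convex_hyperplane_section:
  fixes S :: "'a::euclidean_space set"
  assumes S: "convex S" and y: "y1 \<in> S" "u \<bullet> y1 < b" "y2 \<in> S" "b < u \<bullet> y2"
  shows "\<exists>m\<in>rel_interior S. u \<bullet> m = b"
    and "aff_dim (S \<inter> {x. u \<bullet> x = b}) = aff_dim S - 1"
proof -
  let ?H = "{x. u \<bullet> x = b}"
  have cl: "S \<subseteq> closure (rel_interior S)"
    unfolding convex_closure_rel_interior[OF S] by (rule closure_subset)
  have "{x. u \<bullet> x < b} \<inter> closure (rel_interior S) \<noteq> {}" "{x. u \<bullet> x > b} \<inter> closure (rel_interior S) \<noteq> {}"
    using cl y by auto
  then have "{x. u \<bullet> x < b} \<inter> rel_interior S \<noteq> {}" "{x. u \<bullet> x > b} \<inter> rel_interior S \<noteq> {}"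
    by (simp_all add: open_Int_closure_eq_empty open_halfspace_lt open_halfspace_gt)
  then obtain z1 z2 where z: "z1 \<in> rel_interior S" "u \<bullet> z1 < b" "z2 \<in> rel_interior S" "b < u \<bullet> z2"
    by blast
  have "connected (rel_interior S)"
    using S by (simp add: convex_connected convex_rel_interior)
  then show ex: "\<exists>m\<in>rel_interior S. u \<bullet> m = b"
    using connected_ivt_hyperplane[of "rel_interior S" z1 z2 u b] z by auto
  then obtain m where m: "m \<in> rel_interior S" "u \<bullet> m = b" by blast
  let ?L = "affine hull S \<inter> ?H"
  have aL: "affine ?L" by (simp add: affine_Int affine_hyperplane)
  obtain T where "open T" "rel_interior S = affine hull S \<inter> T"
    using openin_rel_interior[of S] by (auto simp: openin_open)
  then have "open T" "rel_interior S \<inter> ?L = ?L \<inter> T" by auto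
  then have op: "openin (top_of_set ?L) (rel_interior S \<inter> ?L)"
    by (metis openin_open)
  have sub: "rel_interior S \<inter> ?L \<subseteq> S \<inter> ?H" "S \<inter> ?H \<subseteq> ?L"
    using rel_interior_subset hull_subset[of S affine] by auto
  have mL: "m \<in> rel_interior S \<inter> ?L"
    using m rel_interior_subset hull_subset[of S affine] by blast
  then have "aff_dim (rel_interior S \<inter> ?L) = aff_dim ?L"
    using aff_dim_openin[OF op aL] by blast
  then have "aff_dim (S \<inter> ?H) = aff_dim ?L"
    using aff_dim_subset[OF sub(1)] aff_dim_subset[OF sub(2)] by linarith
  also have "\<dots> = aff_dim S - 1"
  proof -
    have "?L \<noteq> {}" using mL by blast
    moreover have "y1 \<in> affine hull S" "y1 \<notin> ?H" using y by (auto simp: hull_inc)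
    then have "\<not> affine hull S \<subseteq> ?H" by blast
    ultimately show ?thesis
      using aff_dim_affine_Int_hyperplane[of "affine hull S" u b] by (auto simp: aff_dim_affine_hull)
  qed
  finally show "aff_dim (S \<inter> ?H) = aff_dim S - 1" .
qed

section \<open>Vertices and linear inequalities\<close>

lemma polytope_eq_hull_vert:
  fixes X :: "'a::euclidean_space set"
  assumes "polytope X"
  shows "X = convex hull (vert X)"
  using Krein_Milman_Minkowski[of X] assms polytope_imp_compact polytope_imp_convex by blast

lemma finite_vert:
  fixes X :: "'a::euclidean_space set"
  shows "polytope X \<Longrightarrow> finite (vert X)"
  by (simp add: finite_polyhedron_extreme_points polytope_imp_polyhedron)

lemma vert_in: "v \<in> vert X \<Longrightarrow> v \<in> X"
  by (simp add: extreme_point_of_def)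

text \<open>Carries linear inequalities, strict ones included, from the vertices to the whole
  polytope.\<close>

lemma polytope_subset_vert:
  fixes X :: "'a::euclidean_space set"
  assumes "polytope X" "convex C" "vert X \<subseteq> C"
  shows "X \<subseteq> C"
  using polytope_eq_hull_vert[OF assms(1)] hull_minimal[of "vert X" C convex] assms by auto

lemma vert_above:
  fixes X :: "'a::euclidean_space set"
  assumes "polytope X" "x \<in> X" "p \<bullet> x > t"
  obtains v where "v \<in> vert X" "p \<bullet> v > t"
  using polytope_subset_vert[OF assms(1) convex_halfspace_le[where a=p and b=t]] assms by fastforce

lemma vert_below:
  fixes X :: "'a::euclidean_space set"
  assumes "polytope X" "x \<in> X" "p \<bullet> x < t"
  obtains v where "v \<in> vert X" "p \<bullet> v < t"
  using polytope_subset_vert[OF assms(1) convex_halfspace_ge[where a=p and b=t]] assms by fastforce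

section \<open>Hyperplanes avoiding the vertices\<close>

definition transversal :: "'a::euclidean_space set \<Rightarrow> 'a \<Rightarrow> real \<Rightarrow> bool" where
  "transversal X u b \<longleftrightarrow> polytope X \<and> (\<forall>v\<in>vert X. u \<bullet> v \<noteq> b)"

lemma transversal_face: "transversal X u b \<Longrightarrow> F face_of X \<Longrightarrow> transversal F u b"
  by (auto simp: transversal_def face_of_polytope_polytope extreme_point_of_face)

text \<open>If no vertex lies on the hyperplane and all lie on one side, the whole polytope lies
  strictly on that side. The converse is connectedness.\<close>

lemma transversal_section_iff:
  assumes X: "transversal X u b"
  shows "X \<inter> {x. u \<bullet> x = b} \<noteq> {} \<longleftrightarrow> (\<exists>x\<in>X. u \<bullet> x < b) \<and> (\<exists>x\<in>X. u \<bullet> x > b)"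
proof
  assume "X \<inter> {x. u \<bullet> x = b} \<noteq> {}"
  then obtain x where x: "x \<in> X" "u \<bullet> x = b" by blast
  have pX: "polytope X" and nv: "\<And>v. v \<in> vert X \<Longrightarrow> u \<bullet> v \<noteq> b" using X by (auto simp: transversal_def)
  have "\<not> vert X \<subseteq> {x. u \<bullet> x > b}" "\<not> vert X \<subseteq> {x. u \<bullet> x < b}"
    using polytope_subset_vert[OF pX convex_halfspace_gt] polytope_subset_vert[OF pX convex_halfspace_lt] x
    by fastforce+
  then obtain v w where v: "v \<in> vert X" "\<not> u \<bullet> v > b" and w: "w \<in> vert X" "\<not> u \<bullet> w < b"
    by blast
  then have "u \<bullet> v < b" "u \<bullet> w > b" using nv[OF v(1)] nv[OF w(1)] by auto
  then show "(\<exists>x\<in>X. u \<bullet> x < b) \<and> (\<exists>x\<in>X. u \<bullet> x > b)"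
    using vert_in[OF v(1)] vert_in[OF w(1)] by blast
next
  assume "(\<exists>x\<in>X. u \<bullet> x < b) \<and> (\<exists>x\<in>X. u \<bullet> x > b)"
  then obtain y1 y2 where "y1 \<in> X" "y2 \<in> X" "u \<bullet> y1 \<le> b" "b \<le> u \<bullet> y2"
    by (auto dest: less_imp_le)
  moreover have "connected X"
    using X unfolding transversal_def by (intro convex_connected polytope_imp_convex) blast
  ultimately show "X \<inter> {x. u \<bullet> x = b} \<noteq> {}"
    using connected_ivt_hyperplane[of X y1 y2 u b] by blast
qed

lemma transversal_section:
  assumes X: "transversal X u b" and ne: "X \<inter> {x. u \<bullet> x = b} \<noteq> {}"
  shows "rel_interior X \<inter> {x. u \<bullet> x = b} \<noteq> {}"
    and "aff_dim (X \<inter> {x. u \<bullet> x = b}) = aff_dim X - 1"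
    and "rel_interior (X \<inter> {x. u \<bullet> x = b}) = rel_interior X \<inter> {x. u \<bullet> x = b}"
proof -
  let ?H = "{x. u \<bullet> x = b}"
  have cX: "convex X" using X by (simp add: transversal_def polytope_imp_convex)
  obtain y1 y2 where y: "y1 \<in> X" "u \<bullet> y1 < b" "y2 \<in> X" "u \<bullet> y2 > b"
    using transversal_section_iff[OF X] ne by blast
  show ri: "rel_interior X \<inter> ?H \<noteq> {}" and "aff_dim (X \<inter> ?H) = aff_dim X - 1"
    using convex_hyperplane_section[OF cX y] by auto
  have "rel_interior ?H = ?H" by (simp add: affine_hyperplane rel_interior_affine)
  then show "rel_interior (X \<inter> ?H) = rel_interior X \<inter> ?H"
    using convex_rel_interior_inter_two[OF cX convex_hyperplane, of u b] ri by simp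
qed

text \<open>Take a face of least dimension containing \<open>z\<close>; were \<open>z\<close> on its
  relative boundary, a facet of that face would contain \<open>z\<close> as well.\<close>

lemma polytope_rel_interior_face:
  fixes X :: "'a::euclidean_space set"
  assumes X: "polytope X" and z: "z \<in> X"
  obtains F where "F face_of X" "z \<in> rel_interior F"
proof -
  have "\<exists>F. F face_of X \<and> z \<in> F"
    using z face_of_refl[OF polytope_imp_convex[OF X]] by (intro exI[of _ X]) simp
  then obtain F where F: "F face_of X" "z \<in> F"
    and min: "\<And>G. G face_of X \<Longrightarrow> z \<in> G \<Longrightarrow> nat (aff_dim F) \<le> nat (aff_dim G)"
    using ex_has_least_nat[of "\<lambda>F. F face_of X \<and> z \<in> F" _ "\<lambda>F. nat (aff_dim F)"] by blast
  have pF: "polytope F" using X F by (simp add: face_of_polytope_polytope)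
  have "z \<in> rel_interior F"
  proof (rule ccontr)
    assume "z \<notin> rel_interior F"
    then have "z \<in> F - rel_interior F" using F by blast
    then obtain G where G: "G facet_of F" "z \<in> G"
      using rel_boundary_of_polyhedron[OF polytope_imp_polyhedron[OF pF]] by auto
    then have "G face_of X" using F facet_of_imp_face_of face_of_trans by blast
    moreover have "nat (aff_dim G) < nat (aff_dim F)"
      using G by (auto simp: facet_of_def aff_dim_nonneg_iff) (metis aff_dim_nonneg_iff zle_diff1_eq empty_iff)
    ultimately show False using min[of G] G by linarith
  qed
  then show ?thesis using F that by blast
qed

text \<open>The hyperplane meets the relative interior of \<open>F\<close>, and a face of
  \<open>X\<close> containing a relative interior point of \<open>F\<close> contains
  \<open>F\<close>.\<close>

lemma section_face_subset:
  assumes X: "transversal X u b" and F: "F face_of X" "F \<inter> {x. u \<bullet> x = b} \<noteq> {}" and G: "G face_of X"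
  shows "F \<inter> {x. u \<bullet> x = b} \<subseteq> G \<inter> {x. u \<bullet> x = b} \<longleftrightarrow> F \<subseteq> G"
proof
  assume sub: "F \<inter> {x. u \<bullet> x = b} \<subseteq> G \<inter> {x. u \<bullet> x = b}"
  have "rel_interior F \<inter> {x. u \<bullet> x = b} \<noteq> {}"
    using transversal_section(1)[OF transversal_face[OF X F(1)] F(2)] .
  then have "G \<inter> rel_interior F \<noteq> {}"
    using sub rel_interior_subset by blast
  then show "F \<subseteq> G"
    using subset_of_face_of[OF G face_of_imp_subset[OF F(1)]] by blast
qed blast

text \<open>Injectivity holds because sections reflect inclusion. For surjectivity, a relative
  interior point \<open>z\<close> of \<open>G\<close> lies in the relative interior of some face
  \<open>F\<close> of \<open>X\<close>, hence in that of its section; faces whose relative interiors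
  share a point coincide.\<close>

lemma section_face_bij:
  assumes X: "transversal X u b"
  shows "bij_betw (\<lambda>F. F \<inter> {x. u \<bullet> x = b}) {F. F face_of X \<and> F \<inter> {x. u \<bullet> x = b} \<noteq> {}}
    {G. G face_of (X \<inter> {x. u \<bullet> x = b}) \<and> G \<noteq> {}}"
proof (rule bij_betw_imageI)
  let ?H = "{x. u \<bullet> x = b}"
  show "inj_on (\<lambda>F. F \<inter> ?H) {F. F face_of X \<and> F \<inter> ?H \<noteq> {}}"
  proof (rule inj_onI)
    fix F G assume "F \<in> {F. F face_of X \<and> F \<inter> ?H \<noteq> {}}" "G \<in> {F. F face_of X \<and> F \<inter> ?H \<noteq> {}}"
      and eq: "F \<inter> ?H = G \<inter> ?H"
    then have F: "F face_of X" "F \<inter> ?H \<noteq> {}" and G: "G face_of X" "G \<inter> ?H \<noteq> {}" by blast+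
    show "F = G"
      using section_face_subset[OF X F G(1)] section_face_subset[OF X G F(1)] eq by auto
  qed
  have pX: "polytope X" using X by (simp add: transversal_def)
  show "(\<lambda>F. F \<inter> ?H) ` {F. F face_of X \<and> F \<inter> ?H \<noteq> {}} = {G. G face_of (X \<inter> ?H) \<and> G \<noteq> {}}"
  proof (intro equalityI subsetI)
    fix G assume "G \<in> (\<lambda>F. F \<inter> ?H) ` {F. F face_of X \<and> F \<inter> ?H \<noteq> {}}"
    then show "G \<in> {G. G face_of (X \<inter> ?H) \<and> G \<noteq> {}}"
      using face_of_slice[OF _ convex_hyperplane] by blast
  next
    fix G assume G: "G \<in> {G. G face_of (X \<inter> ?H) \<and> G \<noteq> {}}"
    then have "rel_interior G \<noteq> {}"
      using rel_interior_eq_empty[of G] face_of_imp_convex[of G "X \<inter> ?H"] by simp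
    then obtain z where z: "z \<in> rel_interior G" by blast
    then have zX: "z \<in> X" "z \<in> ?H" using G rel_interior_subset face_of_imp_subset by blast+
    obtain F where F: "F face_of X" "z \<in> rel_interior F"
      using polytope_rel_interior_face[OF pX zX(1)] .
    have ne: "F \<inter> ?H \<noteq> {}" using F zX rel_interior_subset by blast
    have "z \<in> rel_interior (F \<inter> ?H)"
      using transversal_section(3)[OF transversal_face[OF X F(1)] ne] F zX by blast
    moreover have "F \<inter> ?H face_of X \<inter> ?H"
      using F(1) by (intro face_of_slice convex_hyperplane)
    ultimately have "G = F \<inter> ?H"
      using G z by (intro face_of_eq[of G "X \<inter> ?H"]) blast+
    then show "G \<in> (\<lambda>F. F \<inter> ?H) ` {F. F face_of X \<and> F \<inter> ?H \<noteq> {}}"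
      using F ne by blast
  qed
qed

lemma transversal_section_polytope:
  "transversal X u b \<Longrightarrow> polytope (X \<inter> {x. u \<bullet> x = b})"
  by (simp add: transversal_def polytope_Int_polyhedron polyhedron_hyperplane)

text \<open>Induction on the codimension of \<open>F\<close>. The section matches the faces above
  \<open>F\<close> with those above its section and lowers every dimension by one, so the dimension
  differences in \<open>chain_sum_rec\<close> are unchanged.\<close>

lemma up_weight_section:
  assumes X: "transversal X u b" and F: "F face_of X" "F \<inter> {x. u \<bullet> x = b} \<noteq> {}"
  shows "up_weight (X \<inter> {x. u \<bullet> x = b}) (F \<inter> {x. u \<bullet> x = b}) = up_weight X F"
  using F
proof (induction "nat (aff_dim X - aff_dim F)" arbitrary: F rule: less_induct)
  case less
  let ?H = "{x. u \<bullet> x = b}"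
  have pX: "polytope X" using X by (simp add: transversal_def)
  have XX: "X face_of X" using pX by (simp add: face_of_refl polytope_imp_convex)
  show ?case
  proof (cases "F = X")
    case True
    then show ?thesis by (simp add: up_weight_def)
  next
    case False
    have ne: "F \<inter> ?H \<noteq> X \<inter> ?H"
    proof
      assume "F \<inter> ?H = X \<inter> ?H"
      then have "X \<subseteq> F"
        using section_face_subset[OF X XX _ less.prems(1)] less.prems(2) by simp
      then show False using False face_of_imp_subset[OF less.prems(1)] by simp
    qed
    let ?A = "{G. G face_of X \<and> F \<subset> G}"
    have sub: "G \<inter> ?H \<noteq> {}" if "G \<in> ?A" for G using that less.prems by blast
    have psub: "F \<inter> ?H \<subset> G \<inter> ?H \<longleftrightarrow> F \<subset> G" if "G face_of X" "G \<inter> ?H \<noteq> {}" for G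
      using section_face_subset[OF X less.prems that(1)] section_face_subset[OF X that less.prems(1)]
      by (metis psubset_eq subset_antisym order_refl)
    have img: "(\<lambda>F. F \<inter> ?H) ` ?A = {G. G face_of (X \<inter> ?H) \<and> F \<inter> ?H \<subset> G}"
    proof (intro equalityI subsetI)
      fix G assume "G \<in> (\<lambda>F. F \<inter> ?H) ` ?A"
      then obtain G' where G': "G = G' \<inter> ?H" "G' \<in> ?A" by blast
      then show "G \<in> {G. G face_of (X \<inter> ?H) \<and> F \<inter> ?H \<subset> G}"
        using psub[of G'] sub[of G'] face_of_slice[OF _ convex_hyperplane] by blast
    next
      fix G assume G: "G \<in> {G. G face_of (X \<inter> ?H) \<and> F \<inter> ?H \<subset> G}"
      then have "G \<in> {G. G face_of (X \<inter> ?H) \<and> G \<noteq> {}}" by blast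
      then obtain G' where G': "G' face_of X" "G' \<inter> ?H \<noteq> {}" "G = G' \<inter> ?H"
        unfolding bij_betw_imp_surj_on[OF section_face_bij[OF X], symmetric] by blast
      then show "G \<in> (\<lambda>F. F \<inter> ?H) ` ?A" using psub[of G'] G by blast
    qed
    have inj: "inj_on (\<lambda>F. F \<inter> ?H) ?A"
      using bij_betw_imp_inj_on[OF section_face_bij[OF X]] by (rule inj_on_subset) (use sub in blast)
    have dim: "aff_dim (G \<inter> ?H) = aff_dim G - 1" if "G face_of X" "G \<inter> ?H \<noteq> {}" for G
      using transversal_section(2)[OF transversal_face[OF X that(1)] that(2)] .
    have lt: "aff_dim F < aff_dim G" "aff_dim G \<le> aff_dim X" if "G \<in> ?A" for G
    proof -
      have "F face_of G" using that less.prems(1) by (auto intro: face_of_subset dest: face_of_imp_subset)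
      then show "aff_dim F < aff_dim G" using that by (auto intro!: face_of_aff_dim_lt face_of_imp_convex)
      show "aff_dim G \<le> aff_dim X" using that by (auto intro: aff_dim_subset dest: face_of_imp_subset)
    qed
    have "chain_sum (X \<inter> ?H) (F \<inter> ?H) = (\<Sum>G\<in>(\<lambda>F. F \<inter> ?H) ` ?A.
        (va - vb) ^ nat (aff_dim G - aff_dim (F \<inter> ?H) - 1) * up_weight (X \<inter> ?H) G)"
      unfolding img
      by (rule chain_sum_rec[OF transversal_section_polytope[OF X] face_of_slice[OF less.prems(1) convex_hyperplane] ne])
    also have "\<dots> = (\<Sum>G\<in>?A. (va - vb) ^ nat (aff_dim G - aff_dim F - 1) * up_weight X G)"
      unfolding sum.reindex[OF inj] o_def
    proof (intro sum.cong refl arg_cong2[where f = "(*)"] arg_cong[where f = "\<lambda>n. (va - vb) ^ nat n"])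
      fix G assume G: "G \<in> ?A"
      show "aff_dim (G \<inter> ?H) - aff_dim (F \<inter> ?H) - 1 = aff_dim G - aff_dim F - 1"
        using dim[OF _ sub[OF G]] dim[OF less.prems] G by auto
      show "up_weight (X \<inter> ?H) (G \<inter> ?H) = up_weight X G"
        using G lt[OF G] sub[OF G] by (intro less.hyps) auto
    qed
    also have "\<dots> = chain_sum X F"
      using chain_sum_rec[OF pX less.prems(1) False] by simp
    finally show ?thesis using ne False by (simp add: up_weight_def)
  qed
qed

text \<open>
  The factor \<open>a - b\<close> taken off \<open>face_weight\<close> accounts for the dimension lost in a section. For vertices
  the truncated exponent makes both weights agree, so \<open>link_weight\<close> is only used in positive dimension.
\<close>

definition link_weight :: "'a::euclidean_space set \<Rightarrow> 'a set \<Rightarrow> ab ncpoly" where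
  "link_weight X F = (va - vb) ^ nat (aff_dim F - 1) * up_weight X F"

lemma face_weight_section:
  assumes "transversal X u b" "F face_of X" "F \<inter> {x. u \<bullet> x = b} \<noteq> {}"
  shows "face_weight (X \<inter> {x. u \<bullet> x = b}) (F \<inter> {x. u \<bullet> x = b}) = link_weight X F"
  using up_weight_section[OF assms] transversal_section(2)[OF transversal_face[OF assms(1,2)] assms(3)]
  by (simp add: face_weight_def link_weight_def)

lemma face_weight_eq_link_weight:
  "aff_dim F \<ge> 1 \<Longrightarrow> face_weight X F = (va - vb) * link_weight X F"
  by (simp add: face_weight_def link_weight_def mult.assoc[symmetric] power_Suc[symmetric] nat_diff_distrib del: power_Suc)

text \<open>The predicate \<open>P\<close> restricts the faces of the section; it is used to express
  which sides of a second hyperplane they reach.\<close>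

lemma sum_face_weight_section:
  assumes X: "transversal X u b"
  shows "(\<Sum>G | G face_of (X \<inter> {x. u \<bullet> x = b}) \<and> G \<noteq> {} \<and> P G. face_weight (X \<inter> {x. u \<bullet> x = b}) G)
    = (\<Sum>F | F face_of X \<and> F \<inter> {x. u \<bullet> x = b} \<noteq> {} \<and> P (F \<inter> {x. u \<bullet> x = b}). link_weight X F)"
proof -
  let ?H = "{x. u \<bullet> x = b}"
  let ?A = "{F. F face_of X \<and> F \<inter> ?H \<noteq> {} \<and> P (F \<inter> ?H)}"
  note bij = section_face_bij[OF X]
  have img: "{G. G face_of (X \<inter> ?H) \<and> G \<noteq> {} \<and> P G} = (\<lambda>F. F \<inter> ?H) ` ?A"
  proof -
    have "{G. G face_of (X \<inter> ?H) \<and> G \<noteq> {} \<and> P G} = {G \<in> {G. G face_of (X \<inter> ?H) \<and> G \<noteq> {}}. P G}"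
      by auto
    also have "\<dots> = (\<lambda>F. F \<inter> ?H) ` ?A"
      unfolding bij_betw_imp_surj_on[OF bij, symmetric] by blast
    finally show ?thesis .
  qed
  have inj: "inj_on (\<lambda>F. F \<inter> ?H) ?A"
    using bij_betw_imp_inj_on[OF bij] by (rule inj_on_subset) blast
  show ?thesis
    unfolding img sum.reindex[OF inj] o_def by (rule sum.cong) (auto simp: face_weight_section[OF X])
qed

section \<open>Faces at a vertex and the vertex figure\<close>

lemma vertex_figure_section:
  fixes X :: "'a::euclidean_space set"
  assumes X: "polytope X" and v: "v \<in> vert X" and Y: "vertex_figure X v Y"
  obtains u c where "Y = X \<inter> {x. u \<bullet> x = c}" "transversal X u c" "u \<bullet> v < c"
    "\<And>y. y \<in> vert X \<Longrightarrow> y \<noteq> v \<Longrightarrow> c < u \<bullet> y"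
proof -
  obtain u e where *: "e > 0" "\<And>y. y \<in> vert X - {v} \<Longrightarrow> u \<bullet> v + e < u \<bullet> y" "Y = X \<inter> {x. u \<bullet> x = u \<bullet> v + e}"
    using Y unfolding vertex_figure_def by blast
  have far: "u \<bullet> v + e < u \<bullet> y" if "y \<in> vert X" "y \<noteq> v" for y using *(2)[of y] that by simp
  have "u \<bullet> y \<noteq> u \<bullet> v + e" if "y \<in> vert X" for y
    using far[OF that] *(1) by (cases "y = v") auto
  then have "transversal X u (u \<bullet> v + e)" using X by (simp add: transversal_def)
  then show ?thesis using that[OF *(3)] *(1) far by simp
qed

lemma other_vertex:
  fixes F :: "'a::euclidean_space set"
  assumes "polytope F" "v \<in> F" "F \<noteq> {v}"
  obtains y where "y \<in> vert F" "y \<noteq> v"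
proof -
  have "\<not> vert F \<subseteq> {v}"
    using polytope_subset_vert[OF assms(1) convex_singleton, of v] assms by blast
  then show ?thesis using that by blast
qed

text \<open>What matters about a vertex figure: a hyperplane separating \<open>v\<close> from all
  other vertices. The section by it is the figure.\<close>

locale vertex_section =
  fixes X :: "'a::euclidean_space set" and v u :: 'a and c :: real
  assumes trans: "transversal X u c" and v: "v \<in> vert X" and near: "u \<bullet> v < c"
    and far: "\<And>y. y \<in> vert X \<Longrightarrow> y \<noteq> v \<Longrightarrow> c < u \<bullet> y"
begin

lemma poly: "polytope X"
  using trans by (simp add: transversal_def)

text \<open>Only \<open>v\<close> lies below the hyperplane and every other vertex lies above, so a
  face has points on both sides exactly if it has \<open>v\<close> and a further vertex.\<close>

lemma face_meets_iff:
  assumes F: "F face_of X"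
  shows "F \<inter> {x. u \<bullet> x = c} \<noteq> {} \<longleftrightarrow> v \<in> F \<and> F \<noteq> {v}"
proof -
  have pF: "polytope F" using poly F by (rule face_of_polytope_polytope)
  have vF: "w \<in> vert X \<and> w \<in> F" if "w \<in> vert F" for w
    using that F by (simp add: extreme_point_of_face)
  have "(\<exists>x\<in>F. u \<bullet> x < c) \<and> (\<exists>x\<in>F. u \<bullet> x > c) \<longleftrightarrow> v \<in> F \<and> F \<noteq> {v}"
  proof
    assume *: "(\<exists>x\<in>F. u \<bullet> x < c) \<and> (\<exists>x\<in>F. u \<bullet> x > c)"
    then obtain x where "x \<in> F" "u \<bullet> x < c" by blast
    then obtain w where w: "w \<in> vert F" "u \<bullet> w < c" by (rule vert_below[OF pF])
    then have "w = v" using far[of w] vF[OF w(1)] by fastforce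
    moreover have "F \<noteq> {v}" using * near by auto
    ultimately show "v \<in> F \<and> F \<noteq> {v}" using vF[OF w(1)] by simp
  next
    assume *: "v \<in> F \<and> F \<noteq> {v}"
    then obtain y where y: "y \<in> vert F" "y \<noteq> v" using other_vertex[OF pF] by blast
    then have "u \<bullet> y > c" "y \<in> F" using far[of y] vF[OF y(1)] by auto
    then show "(\<exists>x\<in>F. u \<bullet> x < c) \<and> (\<exists>x\<in>F. u \<bullet> x > c)" using * near by blast
  qed
  then show ?thesis using transversal_section_iff[OF transversal_face[OF trans F]] by simp
qed

text \<open>A vertex \<open>y\<close> of \<open>F\<close> above \<open>v\<close> is joined to
  \<open>v\<close> by a segment in \<open>F\<close>; the segment rises from \<open>v\<close>, so its
  crossing with the figure is above \<open>v\<close> too.\<close>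

lemma face_above_iff:
  assumes F: "F face_of X" "v \<in> F"
  shows "(\<exists>x\<in>F \<inter> {x. u \<bullet> x = c}. q \<bullet> x > q \<bullet> v) \<longleftrightarrow> (\<exists>x\<in>F. q \<bullet> x > q \<bullet> v)"
proof
  assume "\<exists>x\<in>F. q \<bullet> x > q \<bullet> v"
  then obtain x where "x \<in> F" "q \<bullet> x > q \<bullet> v" by blast
  moreover have pF: "polytope F" using poly F(1) by (rule face_of_polytope_polytope)
  ultimately obtain y where y: "y \<in> vert F" "q \<bullet> y > q \<bullet> v" by (metis vert_above)
  have "y \<in> vert X" using y F(1) by (simp add: extreme_point_of_face)
  then have uy: "c < u \<bullet> y" using far[of y] y(2) by auto
  have yF: "y \<in> F" using y(1) by (rule vert_in)
  \<comment> \<open>The parameter at which the segment from \<open>v\<close> to \<open>y\<close>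
    reaches level \<open>c\<close>.\<close>
  define s where "s = (c - u \<bullet> v) / (u \<bullet> y - u \<bullet> v)"
  have s: "0 < s" "s \<le> 1" using near uy by (simp_all add: s_def divide_simps)
  define z where "z = (1 - s) *\<^sub>R v + s *\<^sub>R y"
  have "z \<in> F"
    unfolding z_def using convexD[OF polytope_imp_convex[OF pF] F(2) yF, of "1 - s" s] s by simp
  moreover have "s * (u \<bullet> y - u \<bullet> v) = c - u \<bullet> v" using near uy by (simp add: s_def)
  then have "u \<bullet> z = c" by (simp add: z_def inner_add_right algebra_simps)
  moreover have "s * (q \<bullet> y - q \<bullet> v) > 0" using s y(2) by simp
  then have "q \<bullet> z > q \<bullet> v" by (simp add: z_def inner_add_right algebra_simps)
  ultimately show "\<exists>x\<in>F \<inter> {x. u \<bullet> x = c}. q \<bullet> x > q \<bullet> v" by blast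
qed blast

lemma face_below_iff:
  assumes "F face_of X" "v \<in> F"
  shows "(\<exists>x\<in>F \<inter> {x. u \<bullet> x = c}. q \<bullet> x < q \<bullet> v) \<longleftrightarrow> (\<exists>x\<in>F. q \<bullet> x < q \<bullet> v)"
  using face_above_iff[OF assms, of "- q"] by simp

lemma face_sides:
  assumes inj: "inj_on (\<lambda>x. p \<bullet> x) (vert X)" and F: "F face_of X" "v \<in> F" "F \<noteq> {v}"
  shows "(\<exists>x\<in>F. p \<bullet> x > p \<bullet> v) \<or> (\<exists>x\<in>F. p \<bullet> x < p \<bullet> v)"
proof -
  obtain y where y: "y \<in> vert F" "y \<noteq> v"
    using other_vertex[OF face_of_polytope_polytope[OF poly F(1)] F(2,3)] .
  then have "y \<in> vert X" "y \<in> F" using F(1) by (simp_all add: extreme_point_of_face)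
  then have "p \<bullet> y \<noteq> p \<bullet> v" using inj_onD[OF inj _ _ v] y(2) by blast
  then show ?thesis using \<open>y \<in> F\<close> by (metis linorder_neqE)
qed

text \<open>A vertex \<open>w\<close> of the figure is the section of a larger face at
  \<open>v\<close>. That face has a further vertex, hence points off the level of \<open>v\<close>,
  and so has its section \<open>{w}\<close>.\<close>

lemma transversal_vertex_figure:
  assumes inj: "inj_on (\<lambda>x. p \<bullet> x) (vert X)"
  shows "transversal (X \<inter> {x. u \<bullet> x = c}) p (p \<bullet> v)"
  unfolding transversal_def
proof (intro conjI ballI notI)
  show "polytope (X \<inter> {x. u \<bullet> x = c})" by (rule transversal_section_polytope[OF trans])
  fix w assume w: "w \<in> vert (X \<inter> {x. u \<bullet> x = c})" "p \<bullet> w = p \<bullet> v"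
  then have "{w} \<in> {G. G face_of (X \<inter> {x. u \<bullet> x = c}) \<and> G \<noteq> {}}"
    by (simp add: face_of_singleton)
  then obtain F where F: "F face_of X" "F \<inter> {x. u \<bullet> x = c} \<noteq> {}" "{w} = F \<inter> {x. u \<bullet> x = c}"
    unfolding bij_betw_imp_surj_on[OF section_face_bij[OF trans], symmetric] by blast
  then have vF: "v \<in> F" "F \<noteq> {v}" using face_meets_iff by blast+
  have "(\<exists>x\<in>{w}. p \<bullet> x > p \<bullet> v) \<or> (\<exists>x\<in>{w}. p \<bullet> x < p \<bullet> v)"
    using face_sides[OF inj F(1) vF] face_above_iff[OF F(1) vF(1), of p] face_below_iff[OF F(1) vF(1), of p]
    unfolding F(3) by blast
  then show False using w(2) by simp
qed

end

section \<open>The sweep\<close>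

text \<open>The ab-index for a nonempty polytope. For the empty set it is 0, as the convention for
  \<open>cd_index\<close> requires, whereas \<open>ab_index {}\<close> is 1.\<close>

definition face_sum :: "'a::euclidean_space set \<Rightarrow> ab ncpoly" where
  "face_sum X = (\<Sum>F | F face_of X \<and> F \<noteq> {}. face_weight X F)"

text \<open>Picked among the vertices of \<open>X\<close>, so that it can index a grouping of all
  nonempty faces; unique when \<open>p\<close> is injective on them. With \<open>- p\<close> it is
  the bottom vertex.\<close>

definition top_vertex :: "'a \<Rightarrow> 'a::euclidean_space set \<Rightarrow> 'a set \<Rightarrow> 'a" where
  "top_vertex p X F = (SOME v. v \<in> vert X \<and> v \<in> F \<and> (\<forall>x\<in>F. p \<bullet> x \<le> p \<bullet> v))"

lemma top_vertex:
  fixes X :: "'a::euclidean_space set"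
  assumes X: "polytope X" and F: "F face_of X" "F \<noteq> {}"
  shows "top_vertex p X F \<in> vert X" "top_vertex p X F \<in> F" "\<And>x. x \<in> F \<Longrightarrow> p \<bullet> x \<le> p \<bullet> top_vertex p X F"
proof -
  have pF: "polytope F" using X F(1) by (rule face_of_polytope_polytope)
  have "vert F \<noteq> {}" using polytope_eq_hull_vert[OF pF] F(2) by (metis convex_hull_empty)
  then have "Max ((\<bullet>) p ` vert F) \<in> (\<bullet>) p ` vert F"
    using finite_vert[OF pF] by (intro Max_in) auto
  then obtain v where "v \<in> vert F" and eq: "p \<bullet> v = Max ((\<bullet>) p ` vert F)" by force
  then have v: "v \<in> vert F" "vert F \<subseteq> {x. p \<bullet> x \<le> p \<bullet> v}"
    using finite_vert[OF pF] by (auto intro!: Max_ge simp: eq)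
  have "F \<subseteq> {x. p \<bullet> x \<le> p \<bullet> v}"
    using polytope_subset_vert[OF pF convex_halfspace_le v(2)] .
  then have "v \<in> vert X \<and> v \<in> F \<and> (\<forall>x\<in>F. p \<bullet> x \<le> p \<bullet> v)"
    using v(1) F(1) by (auto simp: extreme_point_of_face)
  then have "top_vertex p X F \<in> vert X \<and> top_vertex p X F \<in> F \<and> (\<forall>x\<in>F. p \<bullet> x \<le> p \<bullet> top_vertex p X F)"
    unfolding top_vertex_def by (rule someI)
  then show "top_vertex p X F \<in> vert X" "top_vertex p X F \<in> F" "\<And>x. x \<in> F \<Longrightarrow> p \<bullet> x \<le> p \<bullet> top_vertex p X F"
    by blast+
qed

lemma top_vertex_eq_iff:
  fixes X :: "'a::euclidean_space set"
  assumes "polytope X" "F face_of X" "F \<noteq> {}" "inj_on (\<lambda>x. p \<bullet> x) (vert X)" "v \<in> vert X"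
  shows "top_vertex p X F = v \<longleftrightarrow> v \<in> F \<and> (\<forall>x\<in>F. p \<bullet> x \<le> p \<bullet> v)"
proof
  assume "v \<in> F \<and> (\<forall>x\<in>F. p \<bullet> x \<le> p \<bullet> v)"
  then have "p \<bullet> top_vertex p X F = p \<bullet> v"
    using top_vertex(2,3)[OF assms(1-3), where p = p] by (intro order_antisym) auto
  then show "top_vertex p X F = v"
    using inj_onD[OF assms(4)] top_vertex(1)[OF assms(1-3)] assms(5) by blast
qed (use top_vertex(2,3)[OF assms(1-3), where p = p] in auto)

text \<open>All terms are sums of link weights over faces at \<open>v\<close>: \<open>U\<close>
  reaches above \<open>v\<close>, \<open>D\<close> below, and \<open>T\<close> and \<open>B\<close>
  have \<open>v\<close> as top and bottom vertex. Since \<open>N\<close> is the disjoint union of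
  \<open>U\<close> and \<open>T\<close>, and \<open>U\<close> that of \<open>U \<inter> D\<close>
  and \<open>B\<close>, both sides become \<open>vb * w U + va * w B\<close>.\<close>

lemma vertex_contribution:
  fixes X :: "'a::euclidean_space set"
  assumes X: "polytope X" "aff_dim X > 0" and v: "v \<in> vert X" and Y: "vertex_figure X v Y"
    and inj: "inj_on (\<lambda>x. p \<bullet> x) (vert X)"
  shows "(va + vb) * (\<Sum>G | G face_of Y \<and> (\<exists>x\<in>G. p \<bullet> x > p \<bullet> v). face_weight Y G)
      - va * (va - vb) * face_sum (Y \<inter> {x. p \<bullet> x = p \<bullet> v})
    = (\<Sum>F | F face_of X \<and> F \<noteq> {} \<and> top_vertex p X F = v. face_weight X F)
      - va * (\<Sum>F | F face_of X \<and> aff_dim F \<ge> 1 \<and> top_vertex p X F = v. link_weight X F)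
      + va * (\<Sum>F | F face_of X \<and> aff_dim F \<ge> 1 \<and> top_vertex (- p) X F = v. link_weight X F)"
    and "transversal Y p (p \<bullet> v)"
proof -
  obtain u c where Yeq: "Y = X \<inter> {x. u \<bullet> x = c}" and "transversal X u c" "u \<bullet> v < c"
    "\<And>y. y \<in> vert X \<Longrightarrow> y \<noteq> v \<Longrightarrow> c < u \<bullet> y"
    using vertex_figure_section[OF X(1) v Y] by blast
  then interpret vertex_section X v u c using v by unfold_locales
  show trY: "transversal Y p (p \<bullet> v)"
    unfolding Yeq by (rule transversal_vertex_figure[OF inj])
  \<comment> \<open>The faces met by the vertex figure.\<close>
  define N where "N = {F. F face_of X \<and> v \<in> F \<and> F \<noteq> {v}}"
  define U where "U = {F \<in> N. \<exists>x\<in>F. p \<bullet> x > p \<bullet> v}"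
  define D where "D = {F \<in> N. \<exists>x\<in>F. p \<bullet> x < p \<bullet> v}"
  define T where "T = {F. F face_of X \<and> aff_dim F \<ge> 1 \<and> top_vertex p X F = v}"
  define B where "B = {F. F face_of X \<and> aff_dim F \<ge> 1 \<and> top_vertex (- p) X F = v}"
  define w where "w = (\<lambda>A. \<Sum>F\<in>A. link_weight X F)"
  have finN: "finite N" unfolding N_def by (rule finite_subset[OF _ finite_polytope_faces[OF X(1)]]) blast
  have inj': "inj_on (\<lambda>x. - p \<bullet> x) (vert X)" using inj by (simp add: inj_on_def)
  have dimN: "aff_dim F \<ge> 1 \<longleftrightarrow> F \<noteq> {v}" if "v \<in> F" for F
  proof
    assume "F \<noteq> {v}"
    moreover have "aff_dim F \<ge> 0" using that by (auto simp: aff_dim_nonneg_iff)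
    moreover have "aff_dim F \<noteq> 0" using \<open>F \<noteq> {v}\<close> that by (auto simp: aff_dim_eq_0)
    ultimately show "aff_dim F \<ge> 1" by simp
  qed auto
  have top: "top_vertex q X F = v \<longleftrightarrow> v \<in> F \<and> (\<forall>x\<in>F. q \<bullet> x \<le> q \<bullet> v)"
    if "F face_of X" "F \<noteq> {}" "inj_on (\<lambda>x. q \<bullet> x) (vert X)" for q F
    using top_vertex_eq_iff[OF X(1) that v] .
  have memT: "F \<in> T \<longleftrightarrow> F \<in> N \<and> (\<forall>x\<in>F. p \<bullet> x \<le> p \<bullet> v)" for F
    using top[of F p] inj dimN[of F] aff_dim_empty_eq[where 'a='a]
    unfolding T_def N_def by (cases "F = {}") auto
  have memB: "F \<in> B \<longleftrightarrow> F \<in> N \<and> (\<forall>x\<in>F. p \<bullet> x \<ge> p \<bullet> v)" for F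
    using top[of F "- p"] inj' dimN[of F] aff_dim_empty_eq[where 'a='a]
    unfolding B_def N_def by (cases "F = {}") auto
  have UT: "N = U \<union> T" "U \<inter> T = {}"
    unfolding set_eq_iff Un_iff Int_iff memT U_def by (auto simp: not_le dest: leD)
  have UD: "U = (U \<inter> D) \<union> B" "(U \<inter> D) \<inter> B = {}"
  proof -
    \<comment> \<open>A face at \<open>v\<close> other than \<open>{v}\<close> leaves the level of
      \<open>v\<close>; with bottom vertex \<open>v\<close> it can only do so upward.\<close>
    have "F \<in> U" if "F \<in> B" for F
      using that memB[of F] face_sides[OF inj, of F] unfolding U_def N_def by fastforce
    moreover have "F \<in> D \<longleftrightarrow> F \<notin> B" if "F \<in> N" for F
      using that unfolding memB D_def by (auto simp: not_le dest: leD)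
    moreover have "U \<subseteq> N" by (auto simp: U_def)
    ultimately show "U = (U \<inter> D) \<union> B" "(U \<inter> D) \<inter> B = {}"
      by blast+
  qed
  have fin: "finite U" "finite T" "finite B" "finite (U \<inter> D)"
    using finN UT UD by (metis finite_Un)+
  have wN: "w N = w U + w T" and wU: "w U = w (U \<inter> D) + w B"
    unfolding w_def using fin UT UD by (metis sum.union_disjoint)+
  have sumU: "(\<Sum>G | G face_of Y \<and> (\<exists>x\<in>G. p \<bullet> x > p \<bullet> v). face_weight Y G) = w U"
  proof -
    have "{G. G face_of Y \<and> (\<exists>x\<in>G. p \<bullet> x > p \<bullet> v)} = {G. G face_of Y \<and> G \<noteq> {} \<and> (\<exists>x\<in>G. p \<bullet> x > p \<bullet> v)}"
      by blast
    moreover have "{F. F face_of X \<and> F \<inter> {x. u \<bullet> x = c} \<noteq> {} \<and> (\<exists>x\<in>F \<inter> {x. u \<bullet> x = c}. p \<bullet> x > p \<bullet> v)} = U"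
      unfolding U_def N_def using face_meets_iff face_above_iff by blast
    ultimately show ?thesis
      unfolding Yeq w_def using sum_face_weight_section[OF trans, of "\<lambda>G. \<exists>x\<in>G. p \<bullet> x > p \<bullet> v"] by simp
  qed
  \<comment> \<open>The faces of the slice come from the faces of the figure with points on both
    sides. These have positive dimension, so the factor \<open>va - vb\<close> turns their link
    weights in the figure into face weights.\<close>
  have sumR: "(va - vb) * face_sum (Y \<inter> {x. p \<bullet> x = p \<bullet> v}) = w (U \<inter> D)"
  proof -
    have "(va - vb) * face_sum (Y \<inter> {x. p \<bullet> x = p \<bullet> v})
        = (\<Sum>G | G face_of Y \<and> G \<inter> {x. p \<bullet> x = p \<bullet> v} \<noteq> {}. (va - vb) * link_weight Y G)"
      using sum_face_weight_section[OF trY, of "\<lambda>G. True"] by (simp add: face_sum_def sum_distrib_left)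
    also have "\<dots> = (\<Sum>G | G face_of Y \<and> G \<noteq> {} \<and> (\<exists>x\<in>G. p \<bullet> x < p \<bullet> v) \<and> (\<exists>x\<in>G. p \<bullet> x > p \<bullet> v). face_weight Y G)"
    proof (rule sum.cong)
      show "{G. G face_of Y \<and> G \<inter> {x. p \<bullet> x = p \<bullet> v} \<noteq> {}}
          = {G. G face_of Y \<and> G \<noteq> {} \<and> (\<exists>x\<in>G. p \<bullet> x < p \<bullet> v) \<and> (\<exists>x\<in>G. p \<bullet> x > p \<bullet> v)}"
        using transversal_section_iff[OF transversal_face[OF trY]] by blast
    next
      fix G assume G: "G \<in> {G. G face_of Y \<and> G \<noteq> {} \<and> (\<exists>x\<in>G. p \<bullet> x < p \<bullet> v) \<and> (\<exists>x\<in>G. p \<bullet> x > p \<bullet> v)}"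
      then have "transversal G p (p \<bullet> v)" using transversal_face[OF trY] by blast
      moreover from this have "G \<inter> {x. p \<bullet> x = p \<bullet> v} \<noteq> {}" using transversal_section_iff G by blast
      ultimately have "aff_dim (G \<inter> {x. p \<bullet> x = p \<bullet> v}) = aff_dim G - 1" "aff_dim (G \<inter> {x. p \<bullet> x = p \<bullet> v}) \<ge> 0"
        using transversal_section(2) aff_dim_nonneg_iff by blast+
      then show "(va - vb) * link_weight Y G = face_weight Y G"
        by (simp add: face_weight_eq_link_weight)
    qed
    also have "\<dots> = (\<Sum>F | F face_of X \<and> F \<inter> {x. u \<bullet> x = c} \<noteq> {} \<and>
        (\<exists>x\<in>F \<inter> {x. u \<bullet> x = c}. p \<bullet> x < p \<bullet> v) \<and> (\<exists>x\<in>F \<inter> {x. u \<bullet> x = c}. p \<bullet> x > p \<bullet> v). link_weight X F)"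
      unfolding Yeq by (rule sum_face_weight_section[OF trans])
    also have "{F. F face_of X \<and> F \<inter> {x. u \<bullet> x = c} \<noteq> {} \<and>
        (\<exists>x\<in>F \<inter> {x. u \<bullet> x = c}. p \<bullet> x < p \<bullet> v) \<and> (\<exists>x\<in>F \<inter> {x. u \<bullet> x = c}. p \<bullet> x > p \<bullet> v)} = U \<inter> D"
      unfolding U_def D_def N_def using face_meets_iff face_above_iff face_below_iff by blast
    finally show ?thesis by (simp add: w_def)
  qed
  have vface: "{v} face_of X" "{v} \<noteq> X" using v X(2) by (auto simp: face_of_singleton)
  \<comment> \<open>As \<open>{v}\<close> has dimension 0, the exponent in
    \<open>chain_sum_rec\<close> is the one in \<open>link_weight\<close>.\<close>
  have vN: "face_weight X {v} = vb * w N"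
  proof -
    have "{G. G face_of X \<and> {v} \<subset> G} = N" unfolding N_def by blast
    then show ?thesis
      using chain_sum_rec[OF X(1) vface] vface(2)
      by (simp add: face_weight_def up_weight_def w_def link_weight_def)
  qed
  have sumT: "(\<Sum>F | F face_of X \<and> F \<noteq> {} \<and> top_vertex p X F = v. face_weight X F) = vb * w N + (va - vb) * w T"
  proof -
    have "F \<in> {F. F face_of X \<and> F \<noteq> {} \<and> top_vertex p X F = v} \<longleftrightarrow> F \<in> insert {v} T" for F
      using top[of F p] inj memT[of F] vface(1) unfolding N_def by (cases "F = {v}") auto
    then have "{F. F face_of X \<and> F \<noteq> {} \<and> top_vertex p X F = v} = insert {v} T" by blast
    moreover have "{v} \<notin> T" by (simp add: T_def)
    moreover have "(\<Sum>F\<in>T. face_weight X F) = (va - vb) * w T"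
      unfolding w_def sum_distrib_left by (rule sum.cong) (auto simp: T_def face_weight_eq_link_weight)
    ultimately show ?thesis using fin vN by simp
  qed
  have wT: "(\<Sum>F | F face_of X \<and> aff_dim F \<ge> 1 \<and> top_vertex p X F = v. link_weight X F) = w T"
    and wB: "(\<Sum>F | F face_of X \<and> aff_dim F \<ge> 1 \<and> top_vertex (- p) X F = v. link_weight X F) = w B"
    by (simp_all add: w_def T_def B_def)
  show "(va + vb) * (\<Sum>G | G face_of Y \<and> (\<exists>x\<in>G. p \<bullet> x > p \<bullet> v). face_weight Y G)
      - va * (va - vb) * face_sum (Y \<inter> {x. p \<bullet> x = p \<bullet> v})
    = (\<Sum>F | F face_of X \<and> F \<noteq> {} \<and> top_vertex p X F = v. face_weight X F)
      - va * (\<Sum>F | F face_of X \<and> aff_dim F \<ge> 1 \<and> top_vertex p X F = v. link_weight X F)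
      + va * (\<Sum>F | F face_of X \<and> aff_dim F \<ge> 1 \<and> top_vertex (- p) X F = v. link_weight X F)"
    unfolding sumU sumT mult.assoc[of va "va - vb"] sumR wT wB wN wU
    by (simp add: algebra_simps)
qed

section \<open>Inheritance of genericity and summation over the vertices\<close>

lemma polytope_vertex_figure:
  assumes "polytope X" "vertex_figure X v Y"
  shows "polytope Y"
  using assms by (auto simp: vertex_figure_def polytope_Int_polyhedron polyhedron_hyperplane)

lemma iterated_figures_trans:
  "Z \<in> iterated_figures Q Y \<Longrightarrow> Y \<in> iterated_figures Q X \<Longrightarrow> Z \<in> iterated_figures Q X"
  by (induction rule: iterated_figures.induct) (auto intro: iterated_figures.step)

lemma sweep_generic_figure:
  assumes "sweep_generic Q X p" "aff_dim X > 0" "v \<in> vert X"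
  shows "sweep_generic Q (Q X v) p"
proof -
  have "Q X v \<in> iterated_figures Q X"
    using iterated_figures.step[OF iterated_figures.base assms(2)] assms(3) by simp
  then show ?thesis
    using assms(1) iterated_figures_trans unfolding sweep_generic_def by blast
qed

lemma sweep_generic_inj: "sweep_generic Q X p \<Longrightarrow> inj_on (\<lambda>x. p \<bullet> x) (vert X)"
  by (simp add: sweep_generic_def iterated_figures.base)

text \<open>Group the faces by top or bottom vertex. Of the faces of positive dimension with top
  vertex above level \<open>t\<close>, those with bottom vertex above it cancel; the others are cut
  by the hyperplane, and their link weights add up to the face sum of the slice.\<close>

lemma sum_vertex_contributions:
  fixes X :: "'a::euclidean_space set"
  assumes trans: "transversal X p t" and inj: "inj_on (\<lambda>x. p \<bullet> x) (vert X)"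
  shows "(\<Sum>v\<in>vert X \<inter> {x. p \<bullet> x > t}.
      (\<Sum>F | F face_of X \<and> F \<noteq> {} \<and> top_vertex p X F = v. face_weight X F)
      - va * (\<Sum>F | F face_of X \<and> aff_dim F \<ge> 1 \<and> top_vertex p X F = v. link_weight X F)
      + va * (\<Sum>F | F face_of X \<and> aff_dim F \<ge> 1 \<and> top_vertex (- p) X F = v. link_weight X F))
    = (\<Sum>F | F face_of X \<and> (\<exists>x\<in>F. p \<bullet> x > t). face_weight X F) - va * face_sum (X \<inter> {x. p \<bullet> x = t})"
proof -
  let ?V = "vert X \<inter> {x. p \<bullet> x > t}"
  have X: "polytope X" and t: "\<And>v. v \<in> vert X \<Longrightarrow> p \<bullet> v \<noteq> t"
    using trans by (auto simp: transversal_def)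
  have finV: "finite ?V" using finite_vert[OF X] by simp
  have fin: "finite {F. F face_of X \<and> P F}" for P
    by (rule finite_subset[OF _ finite_polytope_faces[OF X]]) blast
  have group: "(\<Sum>v\<in>?V. \<Sum>F | F face_of X \<and> P F \<and> top_vertex q X F = v. f F)
      = (\<Sum>F | F face_of X \<and> P F \<and> top_vertex q X F \<in> ?V. f F)" for P q and f :: "'a set \<Rightarrow> ab ncpoly"
  proof -
    have "(\<Sum>v\<in>?V. \<Sum>F | F face_of X \<and> P F \<and> top_vertex q X F = v. f F)
        = (\<Sum>v\<in>?V. \<Sum>F\<in>{F \<in> {F. F face_of X \<and> P F \<and> top_vertex q X F \<in> ?V}. top_vertex q X F = v}. f F)"
      by (intro sum.cong refl) auto
    also have "\<dots> = (\<Sum>F | F face_of X \<and> P F \<and> top_vertex q X F \<in> ?V. f F)"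
      by (rule sum.group) (use fin finV in auto)
    finally show ?thesis .
  qed
  have top: "top_vertex p X F \<in> ?V \<longleftrightarrow> (\<exists>x\<in>F. p \<bullet> x > t)" if "F face_of X" "F \<noteq> {}" for F
    using top_vertex[OF X that, where p = p] by (auto intro: less_le_trans)
  have bot: "top_vertex (- p) X F \<in> ?V \<longleftrightarrow> \<not> (\<exists>x\<in>F. p \<bullet> x < t)" if F: "F face_of X" "F \<noteq> {}" for F
  proof -
    note b = top_vertex[OF X F, where p = "- p"]
    have "p \<bullet> top_vertex (- p) X F \<le> p \<bullet> x" if "x \<in> F" for x using b(3)[OF that] by simp
    then show ?thesis using b(1,2) t[of "top_vertex (- p) X F"] by (force simp: not_less)
  qed
  have ne: "F \<noteq> {}" if "aff_dim F \<ge> 1" for F :: "'a set" using that by auto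
  have cut: "{F. F face_of X \<and> F \<inter> {x. p \<bullet> x = t} \<noteq> {}}
      = {F. F face_of X \<and> aff_dim F \<ge> 1 \<and> (\<exists>x\<in>F. p \<bullet> x < t) \<and> (\<exists>x\<in>F. p \<bullet> x > t)}"
  proof -
    have "aff_dim F \<ge> 1" if "F face_of X" "F \<inter> {x. p \<bullet> x = t} \<noteq> {}" for F
      using transversal_section(2)[OF transversal_face[OF trans that(1)] that(2)] that(2)
        aff_dim_nonneg_iff[of "F \<inter> {x. p \<bullet> x = t}"] by simp
    then show ?thesis
      using transversal_section_iff[OF transversal_face[OF trans]] by blast
  qed
  \<comment> \<open>A face whose top vertex is above level \<open>t\<close> has its bottom vertex
    either below, and is cut, or above.\<close>
  have up: "{F. F face_of X \<and> aff_dim F \<ge> 1 \<and> top_vertex p X F \<in> ?V}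
      = {F. F face_of X \<and> F \<inter> {x. p \<bullet> x = t} \<noteq> {}}
        \<union> {F. F face_of X \<and> aff_dim F \<ge> 1 \<and> top_vertex (- p) X F \<in> ?V}" (is "?U = ?C \<union> ?B")
  proof (rule set_eqI)
    fix F
    show "F \<in> ?U \<longleftrightarrow> F \<in> ?C \<union> ?B"
    proof (cases "F face_of X \<and> aff_dim F \<ge> 1")
      case True
      then have F: "F face_of X" "F \<noteq> {}" using ne by blast+
      have "(\<exists>x\<in>F. p \<bullet> x > t)" if "\<not> (\<exists>x\<in>F. p \<bullet> x < t)"
        using bot[OF F] top_vertex(2)[OF X F, where p = "- p"] that by blast
      then show ?thesis
        unfolding cut Un_iff mem_Collect_eq top[OF F] bot[OF F] using True by blast
    next
      case False
      then show ?thesis unfolding cut by blast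
    qed
  qed
  have disj: "?C \<inter> ?B = {}"
    unfolding cut using bot ne by blast
  have "face_sum (X \<inter> {x. p \<bullet> x = t}) = (\<Sum>F\<in>?C. link_weight X F)"
    using sum_face_weight_section[OF trans, of "\<lambda>G. True"] by (simp add: face_sum_def)
  then have "(\<Sum>F\<in>?U. link_weight X F) = face_sum (X \<inter> {x. p \<bullet> x = t}) + (\<Sum>F\<in>?B. link_weight X F)"
    unfolding up by (subst sum.union_disjoint) (use fin disj in auto)
  moreover have "{F. F face_of X \<and> F \<noteq> {} \<and> top_vertex p X F \<in> ?V} = {F. F face_of X \<and> (\<exists>x\<in>F. p \<bullet> x > t)}"
    using top by blast
  ultimately show ?thesis
    unfolding sum.distrib sum_subtractf sum_distrib_left[symmetric] group
    by (simp add: algebra_simps)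
qed

text \<open>Induction on the dimension \<open>m\<close>, applied to the vertex figure at level
  \<open>p \<bullet> v\<close>. The bound \<open>n\<close> stays fixed, so \<open>ex\<close> covers
  the slices arising at every stage, whose dimensions are below \<open>n\<close>.\<close>

lemma sweep_sum_above:
  fixes X :: "'a::euclidean_space set"
  assumes Q: "vertex_figure_choice Q"
    and ex: "\<And>Y :: 'a set. polytope Y \<Longrightarrow> Y \<noteq> {} \<Longrightarrow> aff_dim Y < n \<Longrightarrow>
      ncsubst cd_to_ab (cd_index Y) = ab_index Y"
    and X: "polytope X" "aff_dim X = int m" "int m \<le> n"
    and gen: "sweep_generic Q X p" and t: "\<And>v. v \<in> vert X \<Longrightarrow> p \<bullet> v \<noteq> t"
  shows "ncsubst cd_to_ab (\<Sum>v\<in>vert X \<inter> {x. p \<bullet> x > t}. sweep_cd Q p X v) + va * face_sum (X \<inter> {x. p \<bullet> x = t})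
    = (\<Sum>F | F face_of X \<and> (\<exists>x\<in>F. p \<bullet> x > t). face_weight X F)"
  using X gen t
proof (induction m arbitrary: X t)
  case 0
  then obtain v where v: "X = {v}" using aff_dim_eq_0[of X] by auto
  have pt: "p \<bullet> v \<noteq> t" using 0 by (simp add: v)
  have R: "face_sum (X \<inter> {x. p \<bullet> x = t}) = 0" using pt by (simp add: face_sum_def v)
  have faces: "{F. F face_of X \<and> (\<exists>x\<in>F. p \<bullet> x > t)} = (if p \<bullet> v > t then {{v}} else {})"
  proof -
    have "F = {v}" if "F face_of X" "x \<in> F" for F x using face_of_imp_subset[OF that(1)] that(2) v by auto
    moreover have "{v} face_of X" by (simp add: v face_of_singleton)
    ultimately have "F face_of X \<and> (\<exists>x\<in>F. p \<bullet> x > t) \<longleftrightarrow> F = {v} \<and> p \<bullet> v > t" for F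
      by blast
    then show ?thesis by simp
  qed
  have "face_weight X {v} = 1" by (simp add: v face_weight_def up_weight_def)
  moreover have "vert X \<inter> {x. p \<bullet> x > t} = (if p \<bullet> v > t then {v} else {})" by (auto simp: v)
  moreover have "sweep_cd Q p X v = 1" by (simp add: sweep_cd_def v)
  ultimately show ?case by (simp add: R faces)
next
  case (Suc m)
  have dim: "aff_dim X > 0" using Suc.prems by simp
  have inj: "inj_on (\<lambda>x. p \<bullet> x) (vert X)" using sweep_generic_inj[OF Suc.prems(4)] .
  have trans: "transversal X p t" using Suc.prems(1,5) by (simp add: transversal_def)
  have one: "ncsubst cd_to_ab (sweep_cd Q p X v) =
      (\<Sum>F | F face_of X \<and> F \<noteq> {} \<and> top_vertex p X F = v. face_weight X F)
      - va * (\<Sum>F | F face_of X \<and> aff_dim F \<ge> 1 \<and> top_vertex p X F = v. link_weight X F)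
      + va * (\<Sum>F | F face_of X \<and> aff_dim F \<ge> 1 \<and> top_vertex (- p) X F = v. link_weight X F)"
    if v: "v \<in> vert X" for v
  proof -
    let ?Y = "Q X v"
    let ?R = "?Y \<inter> {x. p \<bullet> x = p \<bullet> v}"
    have vf: "vertex_figure X v ?Y"
      using Q Suc.prems(1) dim v by (simp add: vertex_figure_choice_def)
    have pY: "polytope ?Y" using polytope_vertex_figure[OF Suc.prems(1) vf] .
    have dY: "aff_dim ?Y = int m" using aff_dim_vertex_figure[OF Suc.prems(1) dim v vf] Suc.prems(2) by simp
    note contr = vertex_contribution[OF Suc.prems(1) dim v vf inj]
    have above: "ncsubst cd_to_ab (\<Sum>w\<in>vert ?Y \<inter> {x. p \<bullet> x > p \<bullet> v}. sweep_cd Q p ?Y w) + va * face_sum ?R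
        = (\<Sum>G | G face_of ?Y \<and> (\<exists>x\<in>G. p \<bullet> x > p \<bullet> v). face_weight ?Y G)"
      using contr(2) Suc.prems(3) by (intro Suc.IH pY dY sweep_generic_figure[OF Suc.prems(4) dim v])
        (auto simp: transversal_def)
    have R: "ncsubst cd_to_ab (cd_index ?R) = face_sum ?R"
    proof (cases "?R = {}")
      case True
      then show ?thesis by (simp add: cd_index_def face_sum_def)
    next
      case False
      have "polytope ?R" using contr(2) by (rule transversal_section_polytope)
      moreover have "aff_dim ?R \<le> aff_dim ?Y" by (rule aff_dim_subset) blast
      ultimately show ?thesis
        using ex[of ?R] False dY Suc.prems(3) ab_index_eq_face_weights[of ?R] by (simp add: face_sum_def)
    qed
    have "ncsubst cd_to_ab (sweep_cd Q p X v) = (va * vb + vb * va) * face_sum ?R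
        + (va + vb) * ncsubst cd_to_ab (\<Sum>w\<in>vert ?Y \<inter> {x. p \<bullet> x > p \<bullet> v}. sweep_cd Q p ?Y w)"
      unfolding sweep_cd_rec(2)[OF Q Suc.prems(1) v dim] ncsubst_add ncsubst_var_mult sum_distrib_left[symmetric] R
      by simp
    \<comment> \<open>Uses \<open>va * vb + vb * va = (va + vb) * va - va * (va - vb)\<close>; the
      first term completes the left side of \<open>above\<close>.\<close>
    also have "\<dots> = (va + vb) * (\<Sum>G | G face_of ?Y \<and> (\<exists>x\<in>G. p \<bullet> x > p \<bullet> v). face_weight ?Y G)
        - va * (va - vb) * face_sum ?R"
      unfolding above[symmetric] by (simp add: algebra_simps)
    finally show ?thesis unfolding contr(1) .
  qed
  have "ncsubst cd_to_ab (\<Sum>v\<in>vert X \<inter> {x. p \<bullet> x > t}. sweep_cd Q p X v)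
      = (\<Sum>F | F face_of X \<and> (\<exists>x\<in>F. p \<bullet> x > t). face_weight X F) - va * face_sum (X \<inter> {x. p \<bullet> x = t})"
    unfolding ncsubst_sum sum_vertex_contributions[OF trans inj, symmetric]
    by (rule sum.cong) (auto simp: one)
  then show ?case by simp
qed

text \<open>Below all vertices the slice is empty and every nonempty face counts. Since
  \<open>ex\<close> concerns smaller dimensions only, the result also produces a preimage of the
  ab-index of \<open>X\<close> in an induction.\<close>

lemma sweep_sum:
  fixes X :: "'a::euclidean_space set"
  assumes Q: "vertex_figure_choice Q"
    and ex: "\<And>Y :: 'a set. polytope Y \<Longrightarrow> Y \<noteq> {} \<Longrightarrow> aff_dim Y < aff_dim X \<Longrightarrow>
      ncsubst cd_to_ab (cd_index Y) = ab_index Y"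
    and X: "polytope X" "X \<noteq> {}" and gen: "sweep_generic Q X p"
  shows "ncsubst cd_to_ab (\<Sum>v\<in>vert X. sweep_cd Q p X v) = ab_index X"
proof -
  define t where "t = Min ((\<bullet>) p ` vert X) - 1"
  have t: "p \<bullet> v > t" if "v \<in> vert X" for v
  proof -
    have "Min ((\<bullet>) p ` vert X) \<le> p \<bullet> v" using that finite_vert[OF X(1)] by (intro Min_le) auto
    then show ?thesis by (simp add: t_def)
  qed
  have above: "p \<bullet> x > t" if "x \<in> X" for x
    using polytope_subset_vert[OF X(1) convex_halfspace_gt[where a = p and b = t]] t that by blast
  have V: "vert X \<inter> {x. p \<bullet> x > t} = vert X" using t by blast
  have R: "face_sum (X \<inter> {x. p \<bullet> x = t}) = 0"
  proof -
    have "X \<inter> {x. p \<bullet> x = t} = {}" using above by force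
    then show ?thesis by (simp add: face_sum_def)
  qed
  have F: "{F. F face_of X \<and> (\<exists>x\<in>F. p \<bullet> x > t)} = {F. F face_of X \<and> F \<noteq> {}}"
    using above face_of_imp_subset by blast
  have "aff_dim X = int (nat (aff_dim X))" using X(2) by (simp add: aff_dim_nonneg_iff)
  then have "ncsubst cd_to_ab (\<Sum>v\<in>vert X \<inter> {x. p \<bullet> x > t}. sweep_cd Q p X v) + va * face_sum (X \<inter> {x. p \<bullet> x = t})
    = (\<Sum>F | F face_of X \<and> (\<exists>x\<in>F. p \<bullet> x > t). face_weight X F)"
    using t by (intro sweep_sum_above[OF Q ex X(1) _ _ gen, where m = "nat (aff_dim X)"]) auto
  then show ?thesis
    unfolding V R F ab_index_eq_face_weights[OF X] by simp
qed

section \<open>Existence of the cd-index\<close>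

text \<open>Vertices of a polytope are exposed, which gives a supporting hyperplane; half the least
  gap to the other vertices is a sufficiently small depth.\<close>

lemma vertex_figure_exists:
  fixes X :: "'a::euclidean_space set"
  assumes X: "polytope X" and v: "v \<in> vert X"
  shows "\<exists>Y. vertex_figure X v Y"
proof -
  have "{v} exposed_face_of X"
    using v by (simp add: exposed_face_of_polyhedron[OF polytope_imp_polyhedron[OF X]] face_of_singleton)
  then obtain a b where ab: "X \<subseteq> {x. a \<bullet> x \<le> b}" "{v} = X \<inter> {x. a \<bullet> x = b}"
    unfolding exposed_face_of_def by blast
  then have b: "b = a \<bullet> v" by auto
  \<comment> \<open>The element 1 keeps the set nonempty if \<open>v\<close> is the only
    vertex.\<close>
  define D where "D = insert 1 ((\<lambda>y. a \<bullet> v - a \<bullet> y) ` (vert X - {v}))"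
  have finD: "finite D" using finite_vert[OF X] by (simp add: D_def)
  have pos: "d > 0" if "d \<in> D" for d
  proof -
    have "a \<bullet> y < a \<bullet> v" if "y \<in> vert X - {v}" for y
      using that ab vert_in[of y X] unfolding b by (force simp: order_less_le)
    then show ?thesis using that unfolding D_def by fastforce
  qed
  define e where "e = Min D / 2"
  have "Min D > 0" using pos Min_in[OF finD] by (auto simp: D_def)
  moreover have "Min D \<le> a \<bullet> v - a \<bullet> y" if "y \<in> vert X - {v}" for y
    using finD that by (intro Min_le) (auto simp: D_def)
  ultimately have "e > 0" "\<And>y. y \<in> vert X - {v} \<Longrightarrow> - a \<bullet> v + e < - a \<bullet> y"
    by (force simp: e_def)+
  then have "vertex_figure X v (X \<inter> {x. - a \<bullet> x = - a \<bullet> v + e})"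
    unfolding vertex_figure_def using ab unfolding b
    by (intro exI[of _ "- a"] exI[of _ e]) auto
  then show ?thesis by blast
qed

section \<open>Choices of vertex figures and generic directions\<close>

lemma vertex_figure_choice_exists: "\<exists>Q. vertex_figure_choice Q"
proof
  show "vertex_figure_choice (\<lambda>X v. SOME Y. vertex_figure X v Y)"
    unfolding vertex_figure_choice_def using someI_ex[OF vertex_figure_exists] by blast
qed

text \<open>A polytope has finitely many vertices and each figure loses a dimension, so the tree of
  figures is finite.\<close>

lemma finite_iterated_figures:
  fixes X :: "'a::euclidean_space set"
  assumes Q: "vertex_figure_choice Q" and X: "polytope X"
  shows "finite (iterated_figures Q X) \<and> (\<forall>Y\<in>iterated_figures Q X. polytope Y)"
  using X
proof (induction "nat (aff_dim X)" arbitrary: X rule: less_induct)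
  case less
  \<comment> \<open>\<open>iterated_figures\<close> appends the last figure taken; the induction on
    dimension needs the first one split off instead.\<close>
  have sub: "Y = X \<or> aff_dim X > 0 \<and> (\<exists>v\<in>vert X. Y \<in> iterated_figures Q (Q X v))"
    if "Y \<in> iterated_figures Q X" for Y
    using that
  proof induction
    case (step Z w)
    show ?case
    proof (cases "Z = X")
      case True
      then show ?thesis using step.hyps(2,3) iterated_figures.base by blast
    next
      case False
      then obtain v where "aff_dim X > 0" "v \<in> vert X" "Z \<in> iterated_figures Q (Q X v)"
        using step.IH by blast
      then show ?thesis using iterated_figures.step[OF _ step.hyps(2,3)] by blast
    qed
  qed simp
  show ?case
  proof (cases "aff_dim X > 0")
    case True
    have "finite (iterated_figures Q (Q X v)) \<and> (\<forall>Y\<in>iterated_figures Q (Q X v). polytope Y)" if v: "v \<in> vert X" for v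
    proof -
      have vf: "vertex_figure X v (Q X v)"
        using Q less.prems True v by (simp add: vertex_figure_choice_def)
      have "aff_dim (Q X v) = aff_dim X - 1"
        using aff_dim_vertex_figure[OF less.prems True v vf] .
      then show ?thesis
        using polytope_vertex_figure[OF less.prems vf] True by (intro less.hyps) auto
    qed
    moreover have "iterated_figures Q X \<subseteq> insert X (\<Union>v\<in>vert X. iterated_figures Q (Q X v))"
      using sub by blast
    ultimately show ?thesis
      using finite_vert[OF less.prems] less.prems
      by (auto intro: finite_subset[of _ "insert X (\<Union>v\<in>vert X. iterated_figures Q (Q X v))"])
  next
    case False
    then have "iterated_figures Q X \<subseteq> {X}" using sub by blast
    then show ?thesis using less.prems finite_subset by blast
  qed
qed

text \<open>A direction is generic if it is orthogonal to no nonzero difference of two vertices of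
  one iterated figure. This excludes finitely many hyperplanes, which form a negligible set.\<close>

lemma sweep_generic_exists:
  fixes X :: "'a::euclidean_space set"
  assumes "vertex_figure_choice Q" "polytope X"
  shows "\<exists>p. sweep_generic Q X p"
proof -
  let ?I = "iterated_figures Q X"
  note I = finite_iterated_figures[OF assms]
  define D where "D = (\<Union>Y\<in>?I. (\<lambda>(v, w). v - w) ` (vert Y \<times> vert Y)) - {0}"
  have "finite D" using I by (auto simp: D_def intro!: finite_vert)
  then have "negligible (\<Union>((\<lambda>w. {p. w \<bullet> p = 0}) ` D))"
    by (intro negligible_Union) (auto simp: D_def intro!: negligible_hyperplane)
  then have "(\<Union>((\<lambda>w. {p. w \<bullet> p = 0}) ` D)) \<noteq> UNIV"
    using non_negligible_UNIV by metis
  then obtain p where p: "\<And>w. w \<in> D \<Longrightarrow> w \<bullet> p \<noteq> 0" by blast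
  have "inj_on (\<lambda>x. p \<bullet> x) (vert Y)" if "Y \<in> ?I" for Y
  proof (rule inj_onI, rule ccontr)
    fix v w assume vw: "v \<in> vert Y" "w \<in> vert Y" "p \<bullet> v = p \<bullet> w" "v \<noteq> w"
    then have "(v, w) \<in> vert Y \<times> vert Y" by blast
    then have "v - w \<in> D" using that vw(4) unfolding D_def by force
    then show False using p[of "v - w"] vw(3) by (simp add: inner_diff_right inner_commute[of _ p])
  qed
  then show ?thesis by (auto simp: sweep_generic_def)
qed

text \<open>By induction on the dimension, with figures and a direction chosen anew for each
  polytope. This is how slices on which the original \<open>p\<close> is constant obtain a
  cd-index.\<close>

lemma ncsubst_cd_index:
  fixes X :: "'a::euclidean_space set"
  assumes "polytope X" "X \<noteq> {}"
  shows "ncsubst cd_to_ab (cd_index X) = ab_index X"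
  using assms
proof (induction "nat (aff_dim X)" arbitrary: X rule: less_induct)
  case less
  obtain Q :: "'a set \<Rightarrow> 'a \<Rightarrow> 'a set" where Q: "vertex_figure_choice Q"
    using vertex_figure_choice_exists by blast
  obtain p where p: "sweep_generic Q X p" using sweep_generic_exists[OF Q less.prems(1)] by blast
  have "ncsubst cd_to_ab (\<Sum>v\<in>vert X. sweep_cd Q p X v) = ab_index X"
  proof (rule sweep_sum[OF Q _ less.prems p])
    fix Y :: "'a set" assume Y: "polytope Y" "Y \<noteq> {}" "aff_dim Y < aff_dim X"
    then have "aff_dim Y \<ge> 0" by (simp add: aff_dim_nonneg_iff)
    then show "ncsubst cd_to_ab (cd_index Y) = ab_index Y" using Y by (intro less.hyps) auto
  qed
  then show ?case using cd_index_eqI[OF less.prems(2)] by simp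
qed

theorem theorem2:
  fixes P :: "'a::euclidean_space set"
    and p :: "'a"
    and Q :: "'a set \<Rightarrow> 'a \<Rightarrow> 'a set"
    and d :: nat
  assumes "polytope P" and "aff_dim P = int d"
    and "vertex_figure_choice Q"
    and "sweep_generic Q P p"
  shows "cd_index P = (\<Sum>v\<in>vert P. sweep_cd Q p P v)"
proof -
  have ne: "P \<noteq> {}" using assms(2) by auto
  \<comment> \<open>The sweep along the given \<open>Q\<close> and \<open>p\<close> yields a
    preimage of the ab-index, and uniqueness identifies it with \<open>cd_index P\<close>.\<close>
  show ?thesis
    using sweep_sum[OF assms(3) ncsubst_cd_index assms(1) ne assms(4)] by (intro cd_index_eqI[OF ne])
qed

end
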